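(* Let $(G,\mathcal{P})$ and $(H,\mathcal{Q})$ be group pairs. If $(G,\mathcal{P})$ is a quasi-retract of $(H,\mathcal{Q})$ and $(H,\mathcal{Q})$ is relatively finitely presented, then $(G,\mathcal{P})$ is relatively finitely presented.
   Context: A group pair $(G,\mathcal{P})$ consists of a finitely generated group $G$ and a non-empty finite collection $\mathcal{P}$ of subgroups (repetitions allowed); $G/\mathcal{P}=\coprod_{P\in\mathcal{P}}G/P$, viewed as the collection of cosets regarded as subsets of $G$. For $S\subseteq G$ let $\varphi\colon F(S)*\mathop{\ast}_{P\in\mathcal{P}}P\to G$ be induced by inclusions. $S$ is a relative generating set if $\varphi$ is surjective; a relative presentation $\langle S,\mathcal{P}\mid R\rangle$ consists of a relative generating set $S$ and a subset $R$ of the free product normally generating $\ker\varphi$; $(G,\mathcal{P})$ is relatively finitely presented if there is one with $S,R$ finite. Groups carry word metrics for finite generating sets; $f$ is $(L,C)$-Lipschitz if $d(f(x),f(x'))\le L\,d(x,x')+C$. For $L\ge1,C\ge0,M\ge0$, an $(L,C,M)$-Lipschitz map of pairs $f=(f_1,f_2)\colon(G,\mathcal{P})\to(H,\mathcal{Q})$ is an $(L,C)$-Lipschitz $f_1\colon G\to H$ with a function $f_2\colon G/\mathcal{P}\to H/\mathcal{Q}$ such that the Hausdorff distance between $f_1(A)$ and $f_2(A)$ is $<M$ for all $A\in G/\mathcal{P}$. An $(L,C,M)$-quasi-retraction of pairs $(f,r)$ consists of such $f\colon(G,\mathcal{P})\to(H,\mathcal{Q})$ and $r\colon(H,\mathcal{Q})\to(G,\mathcal{P})$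 with $d_G(r_1f_1(g),g)\le C$ for all $g$ and $r_2\circ f_2=\mathrm{id}$. $(G,\mathcal{P})$ is a quasi-retract of $(H,\mathcal{Q})$ if such $(f,r)$ exists for some constants. *)

theory Defs
  imports "HOL-Algebra.Algebra" "HOL-Library.Extended_Real"
begin

text \<open>A collection of subgroups with repetitions allowed is a list of subgroups.\<close>

definition finitely_generated :: "'g monoid \<Rightarrow> bool" where
  "finitely_generated G \<longleftrightarrow>
     (\<exists>S. finite S \<and> S \<subseteq> carrier G \<and> generate G S = carrier G)"

definition group_pair :: "'g monoid \<Rightarrow> 'g set list \<Rightarrow> bool" where
  "group_pair G Ps \<longleftrightarrow> group G \<and> finitely_generated G \<and> Ps \<noteq> [] \<and>
     (\<forall>P \<in> set Ps. subgroup P G)"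

text \<open>G/P as disjoint union over the list: tagged left cosets (i, gP_i).\<close>

definition pair_cosets :: "'g monoid \<Rightarrow> 'g set list \<Rightarrow> (nat \<times> 'g set) set" where
  "pair_cosets G Ps = {(i, l_coset G a (Ps ! i)) | i a. i < length Ps \<and> a \<in> carrier G}"

definition word_length :: "'g monoid \<Rightarrow> 'g set \<Rightarrow> 'g \<Rightarrow> nat" where
  "word_length G S g = (LEAST n. \<exists>ws. length ws = n \<and>
      set ws \<subseteq> S \<union> m_inv G ` S \<and> foldr (\<otimes>\<^bsub>G\<^esub>) ws \<one>\<^bsub>G\<^esub> = g)"

definition word_dist :: "'g monoid \<Rightarrow> 'g set \<Rightarrow> 'g \<Rightarrow> 'g \<Rightarrow> nat" where
  "word_dist G S x y = word_length G S (inv\<^bsub>G\<^esub> x \<otimes>\<^bsub>G\<^esub> y)"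

definition finite_gen_set :: "'g monoid \<Rightarrow> 'g set \<Rightarrow> bool" where
  "finite_gen_set G S \<longleftrightarrow> finite S \<and> S \<subseteq> carrier G \<and> generate G S = carrier G"

definition hausdorff_dist :: "('a \<Rightarrow> 'a \<Rightarrow> nat) \<Rightarrow> 'a set \<Rightarrow> 'a set \<Rightarrow> ereal" where
  "hausdorff_dist d Aa Bb = max (Complete_Lattices.Sup ((\<lambda>x. Complete_Lattices.Inf ((\<lambda>y. ereal (real (d x y))) ` Bb)) ` Aa))
                              (Complete_Lattices.Sup ((\<lambda>y. Complete_Lattices.Inf ((\<lambda>x. ereal (real (d x y))) ` Aa)) ` Bb))"

definition lipschitz_map :: "'g monoid \<Rightarrow> 'g set \<Rightarrow> 'h monoid \<Rightarrow> 'h set \<Rightarrow>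
    real \<Rightarrow> real \<Rightarrow> ('g \<Rightarrow> 'h) \<Rightarrow> bool" where
  "lipschitz_map G SG H SH L C f \<longleftrightarrow> f \<in> carrier G \<rightarrow> carrier H \<and>
     (\<forall>x\<in>carrier G. \<forall>x'\<in>carrier G.
        real (word_dist H SH (f x) (f x')) \<le> L * real (word_dist G SG x x') + C)"

definition lipschitz_pair_map ::
  "'g monoid \<Rightarrow> 'g set list \<Rightarrow> 'g set \<Rightarrow> 'h monoid \<Rightarrow> 'h set list \<Rightarrow> 'h set \<Rightarrow>
   real \<Rightarrow> real \<Rightarrow> real \<Rightarrow> ('g \<Rightarrow> 'h) \<Rightarrow> (nat \<times> 'g set \<Rightarrow> nat \<times> 'h set) \<Rightarrow> bool" where
  "lipschitz_pair_map G Ps SG H Qs SH L C M f1 f2 \<longleftrightarrow>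
     L \<ge> 1 \<and> C \<ge> 0 \<and> M \<ge> 0 \<and>
     lipschitz_map G SG H SH L C f1 \<and>
     f2 \<in> pair_cosets G Ps \<rightarrow> pair_cosets H Qs \<and>
     (\<forall>A \<in> pair_cosets G Ps.
        hausdorff_dist (word_dist H SH) (f1 ` snd A) (snd (f2 A)) < ereal M)"

definition quasi_retraction_pair ::
  "'g monoid \<Rightarrow> 'g set list \<Rightarrow> 'g set \<Rightarrow> 'h monoid \<Rightarrow> 'h set list \<Rightarrow> 'h set \<Rightarrow>
   real \<Rightarrow> real \<Rightarrow> real \<Rightarrow> ('g \<Rightarrow> 'h) \<Rightarrow> (nat \<times> 'g set \<Rightarrow> nat \<times> 'h set) \<Rightarrow>
   ('h \<Rightarrow> 'g) \<Rightarrow> (nat \<times> 'h set \<Rightarrow> nat \<times> 'g set) \<Rightarrow> bool" where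
  "quasi_retraction_pair G Ps SG H Qs SH L C M f1 f2 r1 r2 \<longleftrightarrow>
     lipschitz_pair_map G Ps SG H Qs SH L C M f1 f2 \<and>
     lipschitz_pair_map H Qs SH G Ps SG L C M r1 r2 \<and>
     (\<forall>g\<in>carrier G. real (word_dist G SG (r1 (f1 g)) g) \<le> C) \<and>
     (\<forall>A \<in> pair_cosets G Ps. r2 (f2 A) = A)"

definition quasi_retract_pair ::
  "'g monoid \<Rightarrow> 'g set list \<Rightarrow> 'g set \<Rightarrow> 'h monoid \<Rightarrow> 'h set list \<Rightarrow> 'h set \<Rightarrow> bool" where
  "quasi_retract_pair G Ps SG H Qs SH \<longleftrightarrow>
     (\<exists>L C M f1 f2 r1 r2. quasi_retraction_pair G Ps SG H Qs SH L C M f1 f2 r1 r2)"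

text \<open>Letters: Inl (s, True) = s, Inl (s, False) = s^-1 (s in S);
  Inr (i, p) = the element p of the i-th factor Ps!i.\<close>

type_synonym 'g fp_letter = "('g \<times> bool) + (nat \<times> 'g)"

definition fp_letters :: "'g set \<Rightarrow> 'g set list \<Rightarrow> 'g fp_letter set" where
  "fp_letters S Ps = Inl ` (S \<times> UNIV) \<union> {Inr (i, p) | i p. i < length Ps \<and> p \<in> Ps ! i}"

definition fp_words :: "'g set \<Rightarrow> 'g set list \<Rightarrow> 'g fp_letter list set" where
  "fp_words S Ps = {w. set w \<subseteq> fp_letters S Ps}"

inductive_set fp_rel :: "'g monoid \<Rightarrow> 'g set \<Rightarrow> 'g set list \<Rightarrow>
    ('g fp_letter list \<times> 'g fp_letter list) set"
  for G S Ps where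
  refl: "w \<in> fp_words S Ps \<Longrightarrow> (w, w) \<in> fp_rel G S Ps"
| sym: "(u, v) \<in> fp_rel G S Ps \<Longrightarrow> (v, u) \<in> fp_rel G S Ps"
| trans: "(u, v) \<in> fp_rel G S Ps \<Longrightarrow> (v, w) \<in> fp_rel G S Ps \<Longrightarrow> (u, w) \<in> fp_rel G S Ps"
| cong: "(u, v) \<in> fp_rel G S Ps \<Longrightarrow> x \<in> fp_words S Ps \<Longrightarrow> y \<in> fp_words S Ps \<Longrightarrow>
         (x @ u @ y, x @ v @ y) \<in> fp_rel G S Ps"
| cancel: "s \<in> S \<Longrightarrow> ([Inl (s, b), Inl (s, \<not> b)], []) \<in> fp_rel G S Ps"
| merge: "i < length Ps \<Longrightarrow> p \<in> Ps ! i \<Longrightarrow> q \<in> Ps ! i \<Longrightarrow>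
         ([Inr (i, p), Inr (i, q)], [Inr (i, p \<otimes>\<^bsub>G\<^esub> q)]) \<in> fp_rel G S Ps"
| unit: "i < length Ps \<Longrightarrow> ([Inr (i, \<one>\<^bsub>G\<^esub>)], []) \<in> fp_rel G S Ps"

definition free_prod :: "'g monoid \<Rightarrow> 'g set \<Rightarrow> 'g set list \<Rightarrow> 'g fp_letter list set monoid" where
  "free_prod G S Ps =
     \<lparr> carrier = fp_words S Ps // fp_rel G S Ps,
       monoid.mult = (\<lambda>Aa Bb. fp_rel G S Ps `` {(SOME x. x \<in> Aa) @ (SOME y. y \<in> Bb)}),
       monoid.one = fp_rel G S Ps `` {[]} \<rparr>"

fun eval_letter :: "'g monoid \<Rightarrow> 'g fp_letter \<Rightarrow> 'g" where
  "eval_letter G (Inl (s, True)) = s"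
| "eval_letter G (Inl (s, False)) = inv\<^bsub>G\<^esub> s"
| "eval_letter G (Inr (i, p)) = p"

definition eval_word :: "'g monoid \<Rightarrow> 'g fp_letter list \<Rightarrow> 'g" where
  "eval_word G w = foldr (\<lambda>l acc. eval_letter G l \<otimes>\<^bsub>G\<^esub> acc) w \<one>\<^bsub>G\<^esub>"

definition fp_phi :: "'g monoid \<Rightarrow> 'g fp_letter list set \<Rightarrow> 'g" where
  "fp_phi G Aa = eval_word G (SOME w. w \<in> Aa)"

definition normal_closure :: "('a, 'b) monoid_scheme \<Rightarrow> 'a set \<Rightarrow> 'a set" where
  "normal_closure K R =
     generate K {g \<otimes>\<^bsub>K\<^esub> r \<otimes>\<^bsub>K\<^esub> inv\<^bsub>K\<^esub> g | g r. g \<in> carrier K \<and> r \<in> R}"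

definition relative_generating_set :: "'g monoid \<Rightarrow> 'g set list \<Rightarrow> 'g set \<Rightarrow> bool" where
  "relative_generating_set G Ps S \<longleftrightarrow> S \<subseteq> carrier G \<and>
     fp_phi G ` carrier (free_prod G S Ps) = carrier G"

definition relative_presentation ::
  "'g monoid \<Rightarrow> 'g set list \<Rightarrow> 'g set \<Rightarrow> 'g fp_letter list set set \<Rightarrow> bool" where
  "relative_presentation G Ps S R \<longleftrightarrow> relative_generating_set G Ps S \<and>
     R \<subseteq> carrier (free_prod G S Ps) \<and>
     normal_closure (free_prod G S Ps) R =
       {Aa \<in> carrier (free_prod G S Ps). fp_phi G Aa = \<one>\<^bsub>G\<^esub>}"

definition rel_finitely_presented :: "'g monoid \<Rightarrow> 'g set list \<Rightarrow> bool" where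
  "rel_finitely_presented G Ps \<longleftrightarrow>
     (\<exists>S R. finite S \<and> finite R \<and> relative_presentation G Ps S R)"

end

theory Submission
  imports Defs
begin

text \<open>
  A word over the relative generators is a path in the coned-off Cayley graph, closed iff the word
  evaluates to 1. The finite relator set of \<open>G\<close> consists of the relations between elements of a
  large finite set \<open>F\<close>: the word chosen for \<open>x y\<close> equals the product of the words chosen for \<open>x\<close>
  and \<open>y\<close>, and the word chosen for an element of \<open>F\<close> equals each letter with that value. Let \<open>Q\<close> be
  the group so presented. The map \<open>f\<close> carries a loop in \<open>G\<close> to a loop in \<open>H\<close>, a cone edge becoming a
  short path to the image coset, a cone edge there, and a short path back. The loop in \<open>H\<close> is filled
  by finitely many relators, and \<open>r\<close> carries these to paths with uniformly small steps, which are
  trivial in \<open>Q\<close>; the merging relations of the peripheral factors are preserved exactly. Since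
  \<open>r\<^sub>2 \<circ> f\<^sub>2\<close> is the identity, the round trip takes each cone edge to a cone edge over the same
  coset, so it only conjugates the loop by a short path.
\<close>

section \<open>Words over the relative generators, and the free product as their quotient
  group\<close>

locale relative_words = group G for G :: "'g monoid" (structure) +
  fixes S :: "'g set" and Ps :: "'g set list"
  assumes S_carrier: "S \<subseteq> carrier G"
    and subgroup_Ps: "\<And>i. i < length Ps \<Longrightarrow> subgroup (Ps ! i) G"
begin

abbreviation "W \<equiv> fp_words S Ps"
abbreviation "K \<equiv> free_prod G S Ps"
abbreviation "cls w \<equiv> fp_rel G S Ps `` {w}"

lemma fp_words_simps [simp]:
  "[] \<in> W" "l # w \<in> W \<longleftrightarrow> l \<in> fp_letters S Ps \<and> w \<in> W"
  "u @ v \<in> W \<longleftrightarrow> u \<in> W \<and> v \<in> W"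
  by (auto simp: fp_words_def)

lemma fp_letters_simps [simp]:
  "Inl (s, b) \<in> fp_letters S Ps \<longleftrightarrow> s \<in> S"
  "Inr (i, p) \<in> fp_letters S Ps \<longleftrightarrow> i < length Ps \<and> p \<in> Ps ! i"
  by (auto simp: fp_letters_def)

lemma eval_letter_closed [simp]: "l \<in> fp_letters S Ps \<Longrightarrow> eval_letter G l \<in> carrier G"
  using S_carrier subgroup.mem_carrier[OF subgroup_Ps] by (cases "(G, l)" rule: eval_letter.cases) auto

lemma eval_Nil [simp]: "eval_word G [] = \<one>"
  and eval_Cons [simp]: "eval_word G (l # w) = eval_letter G l \<otimes> eval_word G w"
  by (simp_all add: eval_word_def)

lemma eval_closed [simp]: "w \<in> W \<Longrightarrow> eval_word G w \<in> carrier G"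
  by (induction w) auto

lemma eval_append: "u \<in> W \<Longrightarrow> v \<in> W \<Longrightarrow> eval_word G (u @ v) = eval_word G u \<otimes> eval_word G v"
  by (induction u) (auto simp: m_assoc)

lemma fp_rel_words: "(u, v) \<in> fp_rel G S Ps \<Longrightarrow> u \<in> W \<and> v \<in> W"
  by (induction rule: fp_rel.induct)
    (auto intro: subgroup.m_closed subgroup.one_closed subgroup_Ps)

lemma fp_rel_eval: "(u, v) \<in> fp_rel G S Ps \<Longrightarrow> eval_word G u = eval_word G v"
proof (induction rule: fp_rel.induct)
  case (cong u v x y)
  then show ?case using fp_rel_words[OF cong(1)] by (simp add: eval_append)
next
  case (cancel s b)
  then show ?case using S_carrier by (cases b) auto
next
  case (merge i p q)
  then show ?case using subgroup.mem_carrier[OF subgroup_Ps] by (auto simp: m_assoc)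
qed auto

lemma equiv_fp_rel: "equiv W (fp_rel G S Ps)"
  by (rule equivI)
    (auto simp: refl_on_def sym_def trans_def
      intro: fp_rel.refl fp_rel.sym fp_rel.trans dest: fp_rel_words)

lemma cls_eq: "(u, v) \<in> fp_rel G S Ps \<Longrightarrow> cls u = cls v"
  by (rule equiv_class_eq[OF equiv_fp_rel])

lemma mem_cls: "w \<in> W \<Longrightarrow> w \<in> cls w"
  by (auto intro: fp_rel.refl)

lemma carrier_K: "carrier K = cls ` W"
  by (auto simp: free_prod_def quotient_def)

lemma cls_carrier [simp]: "w \<in> W \<Longrightarrow> cls w \<in> carrier K"
  by (simp add: carrier_K)

lemma some_cls: "w \<in> W \<Longrightarrow> (w, SOME x. x \<in> cls w) \<in> fp_rel G S Ps"
  using someI[of "\<lambda>x. x \<in> cls w", OF mem_cls] by auto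

text \<open>\<open>free_prod\<close> multiplies representatives picked by \<open>SOME\<close>.
  Exchanging them one factor at a time by congruence shows that the choice is immaterial.\<close>

lemma cls_mult: "u \<in> W \<Longrightarrow> v \<in> W \<Longrightarrow> cls u \<otimes>\<^bsub>K\<^esub> cls v = cls (u @ v)"
proof -
  assume uv: "u \<in> W" "v \<in> W"
  define u' v' where "u' = (SOME x. x \<in> cls u)" and "v' = (SOME x. x \<in> cls v)"
  have r: "(u, u') \<in> fp_rel G S Ps" "(v, v') \<in> fp_rel G S Ps"
    unfolding u'_def v'_def using uv some_cls by auto
  have "([] @ u @ v, [] @ u' @ v) \<in> fp_rel G S Ps"
    by (rule fp_rel.cong) (use r uv in auto)
  moreover have "(u' @ v @ [], u' @ v' @ []) \<in> fp_rel G S Ps"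
    by (rule fp_rel.cong) (use r fp_rel_words in auto)
  ultimately have "(u @ v, u' @ v') \<in> fp_rel G S Ps"
    using fp_rel.trans by auto
  from cls_eq[OF this] show ?thesis
    by (simp add: free_prod_def u'_def v'_def)
qed

lemma one_K: "\<one>\<^bsub>K\<^esub> = cls []"
  by (simp add: free_prod_def)

fun inv_letter :: "'g fp_letter \<Rightarrow> 'g fp_letter" where
  "inv_letter (Inl (s, b)) = Inl (s, \<not> b)"
| "inv_letter (Inr (i, p)) = Inr (i, inv p)"

definition inv_word :: "'g fp_letter list \<Rightarrow> 'g fp_letter list" where
  "inv_word w = rev (map inv_letter w)"

lemma inv_letter_closed: "l \<in> fp_letters S Ps \<Longrightarrow> inv_letter l \<in> fp_letters S Ps"
  by (cases l rule: inv_letter.cases) (auto intro: subgroup.m_inv_closed subgroup_Ps)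

lemma inv_word_closed [simp]: "w \<in> W \<Longrightarrow> inv_word w \<in> W"
  by (induction w) (auto simp: inv_word_def inv_letter_closed)

lemma inv_letter_cancel:
  assumes "l \<in> fp_letters S Ps" shows "([inv_letter l, l], []) \<in> fp_rel G S Ps"
proof (cases l rule: inv_letter.cases)
  case (1 s b)
  then show ?thesis using assms fp_rel.cancel[of s S "\<not> b" G Ps] by auto
next
  case (2 i p)
  then have p: "i < length Ps" "p \<in> Ps ! i" "inv p \<in> Ps ! i"
    using assms subgroup.m_inv_closed[OF subgroup_Ps] by auto
  then have "p \<in> carrier G" using subgroup.mem_carrier[OF subgroup_Ps] by auto
  then show ?thesis
    using 2 p fp_rel.merge[of i Ps "inv p" p G S] fp_rel.unit[of i Ps G S] fp_rel.trans by fastforce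
qed

lemma inv_word_cancel: "w \<in> W \<Longrightarrow> (inv_word w @ w, []) \<in> fp_rel G S Ps"
proof (induction w)
  case Nil
  then show ?case by (auto simp: inv_word_def intro: fp_rel.refl)
next
  case (Cons l w)
  then have "(inv_word w @ [inv_letter l, l] @ w, inv_word w @ [] @ w) \<in> fp_rel G S Ps"
    by (intro fp_rel.cong inv_letter_cancel) auto
  with Cons show ?case by (auto simp: inv_word_def intro: fp_rel.trans)
qed

lemma group_K: "group K"
proof (rule groupI)
  fix x assume "x \<in> carrier K"
  then obtain w where w: "w \<in> W" "x = cls w" by (auto simp: carrier_K)
  then have "cls (inv_word w) \<otimes>\<^bsub>K\<^esub> x = \<one>\<^bsub>K\<^esub>"
    using cls_eq[OF inv_word_cancel] by (simp add: cls_mult one_K)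
  then show "\<exists>y\<in>carrier K. y \<otimes>\<^bsub>K\<^esub> x = \<one>\<^bsub>K\<^esub>" using w by auto
qed (auto simp: carrier_K cls_mult one_K)

lemma inv_cls: "w \<in> W \<Longrightarrow> inv\<^bsub>K\<^esub> cls w = cls (inv_word w)"
  using cls_eq[OF inv_word_cancel]
  by (intro group.inv_equality[OF group_K]) (auto simp: cls_mult one_K)

text \<open>\<open>E\<close> controls the edges of the path and also the chord from each vertex to
  the endpoint. Suffixes appear because \<open>\<Phi>_short\<close> collapses a word by peeling off
  its first letter. As \<open>k\<close> is unrestricted, the empty suffix is included.\<close>

definition short :: "'g set \<Rightarrow> 'g fp_letter list \<Rightarrow> bool" where
  "short E w \<longleftrightarrow> w \<in> W \<and> (\<forall>l \<in> set w. eval_letter G l \<in> E) \<and>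
     (\<forall>k. eval_word G (drop k w) \<in> E)"

lemma word_inv_cancel:
  assumes "w \<in> W" shows "(w @ inv_word w, []) \<in> fp_rel G S Ps"
proof -
  interpret K: group K by (rule group_K)
  have "cls (w @ inv_word w) = cls []"
    using K.r_inv[OF cls_carrier[OF assms]] assms by (simp add: inv_cls cls_mult one_K)
  then show ?thesis using mem_cls[of "[]"] by auto
qed

lemma fp_phi_cls: "w \<in> W \<Longrightarrow> fp_phi G (cls w) = eval_word G w"
  unfolding fp_phi_def using fp_rel_eval[OF some_cls] by simp

lemma fp_phi_hom: "group_hom K G (fp_phi G)"
  by (intro group_hom.intro group_hom_axioms.intro group_K is_group homI)
    (auto simp: carrier_K fp_phi_cls cls_mult eval_append)

section \<open>Normal closures and a criterion for relative finite presentability\<close>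

lemma normal_closure_normal:
  assumes "R \<subseteq> carrier K" shows "normal (normal_closure K R) K"
proof -
  interpret K: group K by (rule group_K)
  show ?thesis unfolding normal_closure_def
  proof (rule K.normal_generateI)
    fix h g assume "h \<in> {g \<otimes>\<^bsub>K\<^esub> r \<otimes>\<^bsub>K\<^esub> inv\<^bsub>K\<^esub> g |g r. g \<in> carrier K \<and> r \<in> R}"
      and g: "g \<in> carrier K"
    then obtain a r where h: "h = a \<otimes>\<^bsub>K\<^esub> r \<otimes>\<^bsub>K\<^esub> inv\<^bsub>K\<^esub> a" "a \<in> carrier K" "r \<in> R" by auto
    then have "g \<otimes>\<^bsub>K\<^esub> h \<otimes>\<^bsub>K\<^esub> inv\<^bsub>K\<^esub> g = (g \<otimes>\<^bsub>K\<^esub> a) \<otimes>\<^bsub>K\<^esub> r \<otimes>\<^bsub>K\<^esub> inv\<^bsub>K\<^esub> (g \<otimes>\<^bsub>K\<^esub> a)"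
      using g assms by (auto simp: K.m_assoc K.inv_mult_group subset_iff)
    then show "g \<otimes>\<^bsub>K\<^esub> h \<otimes>\<^bsub>K\<^esub> inv\<^bsub>K\<^esub> g \<in> {g \<otimes>\<^bsub>K\<^esub> r \<otimes>\<^bsub>K\<^esub> inv\<^bsub>K\<^esub> g |g r. g \<in> carrier K \<and> r \<in> R}"
      using g h by blast
  qed (use assms in auto)
qed

lemma mem_normal_closure:
  assumes "R \<subseteq> carrier K" "r \<in> R" shows "r \<in> normal_closure K R"
proof -
  interpret K: group K by (rule group_K)
  have "r = \<one>\<^bsub>K\<^esub> \<otimes>\<^bsub>K\<^esub> r \<otimes>\<^bsub>K\<^esub> inv\<^bsub>K\<^esub> \<one>\<^bsub>K\<^esub>" using assms by auto
  then have "r \<in> {g \<otimes>\<^bsub>K\<^esub> r \<otimes>\<^bsub>K\<^esub> inv\<^bsub>K\<^esub> g |g r. g \<in> carrier K \<and> r \<in> R}"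
    using assms by blast
  then show ?thesis unfolding normal_closure_def by (rule generate.incl)
qed

text \<open>Letters from \<open>S\<close> alone already reach every element, so an ordinary
  generating set is a relative one.\<close>

lemma eval_surj:
  assumes "generate G S = carrier G" shows "eval_word G ` W = carrier G"
proof
  show "eval_word G ` W \<subseteq> carrier G" by auto
  show "carrier G \<subseteq> eval_word G ` W"
  proof
    fix x assume "x \<in> carrier G"
    then have "x \<in> generate G S" using assms by simp
    then show "x \<in> eval_word G ` W"
    proof (induction rule: generate.induct)
      case one
      show ?case by (rule image_eqI[of _ _ "[]"]) auto
    next
      case (incl h)
      then show ?case using S_carrier by (intro image_eqI[of _ _ "[Inl (h, True)]"]) auto
    next
      case (inv h)
      then show ?case using S_carrier by (intro image_eqI[of _ _ "[Inl (h, False)]"]) auto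
    next
      case (eng h1 h2)
      then obtain u v where "u \<in> W" "v \<in> W" "h1 = eval_word G u" "h2 = eval_word G v" by auto
      then show ?case by (intro image_eqI[of _ _ "u @ v"]) (auto simp: eval_append)
    qed
  qed
qed

text \<open>Passes from classes to words. One inclusion is automatic, since the kernel is a subgroup
  containing all conjugates of the relators; \<open>kernel\<close> supplies the other.\<close>

lemma relative_presentationI:
  assumes surj: "eval_word G ` W = carrier G"
    and T: "T \<subseteq> W" "\<And>x. x \<in> T \<Longrightarrow> eval_word G x = \<one>"
    and kernel: "\<And>w. w \<in> W \<Longrightarrow> eval_word G w = \<one> \<Longrightarrow> cls w \<in> normal_closure K (cls ` T)"
  shows "relative_presentation G Ps S (cls ` T)"
proof -
  interpret phi: group_hom K G "fp_phi G" by (rule fp_phi_hom)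
  have sub: "cls ` T \<subseteq> carrier K" using T(1) by auto
  have "normal_closure K (cls ` T) \<subseteq> kernel K G (fp_phi G)"
    unfolding normal_closure_def
    by (rule phi.generate_subgroup_incl[OF _ phi.subgroup_kernel])
      (use sub T in \<open>auto simp: kernel_def fp_phi_cls subset_iff\<close>)
  moreover have "fp_phi G ` carrier K = carrier G"
    using surj fp_phi_cls by (force simp: carrier_K image_iff)
  ultimately show ?thesis
    using kernel sub S_carrier
    by (fastforce simp: relative_presentation_def relative_generating_set_def kernel_def
        carrier_K fp_phi_cls)
qed

text \<open>In the proof \<open>Q\<close> is the free product modulo the normal closure of finitely
  many relators, \<open>\<psi>\<close> the quotient map on words and \<open>\<sigma>\<close> the
  image of a chosen word. Stating \<open>filling\<close> for all such triples lets the geometric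
  argument run in an abstract group in which the relations on \<open>F\<close> hold.\<close>

lemma rel_finitely_presentedI:
  assumes S: "finite S" and surj: "eval_word G ` W = carrier G"
    and F: "finite F" "F \<subseteq> carrier G"
    and filling: "\<And>(Q :: 'g fp_letter list set set monoid) \<psi> \<sigma> w.
      \<lbrakk>group Q; \<And>u. u \<in> W \<Longrightarrow> \<psi> u \<in> carrier Q;
       \<And>u v. u \<in> W \<Longrightarrow> v \<in> W \<Longrightarrow> \<psi> (u @ v) = \<psi> u \<otimes>\<^bsub>Q\<^esub> \<psi> v;
       \<And>u v. (u, v) \<in> fp_rel G S Ps \<Longrightarrow> \<psi> u = \<psi> v;
       \<And>x. x \<in> carrier G \<Longrightarrow> \<sigma> x \<in> carrier Q;
       \<And>x y. x \<in> F \<Longrightarrow> y \<in> F \<Longrightarrow> \<sigma> (x \<otimes> y) = \<sigma> x \<otimes>\<^bsub>Q\<^esub> \<sigma> y;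
       \<And>l. l \<in> fp_letters S Ps \<Longrightarrow> eval_letter G l \<in> F \<Longrightarrow> \<psi> [l] = \<sigma> (eval_letter G l);
       w \<in> W; eval_word G w = \<one>\<rbrakk> \<Longrightarrow> \<psi> w = \<one>\<^bsub>Q\<^esub>"
  shows "rel_finitely_presented G Ps"
proof -
  interpret K: group K by (rule group_K)
  define sec where "sec = inv_into W (eval_word G)"
  have sec: "sec x \<in> W" "eval_word G (sec x) = x" if "x \<in> carrier G" for x
    using surj that by (simp_all add: sec_def inv_into_into f_inv_into_f)
  \<comment> \<open>Peripheral subgroups may be infinite. Only letters with value in
    \<open>F\<close> give relators, and there are finitely many of these because \<open>S\<close>,
    \<open>F\<close> and the list \<open>Ps\<close> are finite.\<close>
  define L where "L = {l \<in> fp_letters S Ps. eval_letter G l \<in> F}"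
  \<comment> \<open>The first family makes \<open>\<sigma>\<close> multiplicative on
    \<open>F\<close>, the second makes it agree with \<open>\<psi>\<close> on letters with value in
    \<open>F\<close>. Each relator ends in an inverted word, the form that \<open>eqI\<close> turns
    into an equation in the quotient.\<close>
  define T where "T = (\<lambda>(x, y). sec x @ sec y @ inv_word (sec (x \<otimes> y))) ` (F \<times> F)
    \<union> (\<lambda>l. l # inv_word (sec (eval_letter G l))) ` L"
  have "L \<subseteq> Inl ` (S \<times> UNIV) \<union> Inr ` ({..<length Ps} \<times> F)"
    by (auto simp: L_def fp_letters_def)
  then have "finite L"
    by (rule finite_subset) (use S F in auto)
  then have finT: "finite T" using F by (auto simp: T_def)
  have eval_inv: "eval_word G (inv_word w) = inv (eval_word G w)" if "w \<in> W" for w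
  proof -
    have "eval_word G (inv_word w) \<otimes> eval_word G w = \<one>"
      using fp_rel_eval[OF inv_word_cancel[OF that]] that by (simp add: eval_append)
    then show ?thesis using that inv_equality by simp
  qed
  have T: "T \<subseteq> W" and evT: "\<And>t. t \<in> T \<Longrightarrow> eval_word G t = \<one>"
    using F sec unfolding T_def L_def
    by (auto simp: subset_iff eval_append eval_inv m_assoc[symmetric])
  define N where "N = normal_closure K (cls ` T)"
  have sub: "cls ` T \<subseteq> carrier K" using T by auto
  interpret N: normal N K
    unfolding N_def using sub by (rule normal_closure_normal)
  define \<psi> where "\<psi> w = N #>\<^bsub>K\<^esub> cls w" for w
  define \<sigma> where "\<sigma> x = \<psi> (sec x)" for x
  interpret Q: group "K Mod N" by (rule N.factorgroup_is_group)
  have clo: "\<psi> u \<in> carrier (K Mod N)" if "u \<in> W" for u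
    using that by (auto simp: \<psi>_def FactGroup_def intro: K.rcosetsI N.subset)
  have app: "\<psi> (u @ v) = \<psi> u \<otimes>\<^bsub>K Mod N\<^esub> \<psi> v" if "u \<in> W" "v \<in> W" for u v
    using that by (simp add: \<psi>_def N.rcos_sum cls_mult flip: cls_mult)
  have rel: "\<psi> u = \<psi> v" if "(u, v) \<in> fp_rel G S Ps" for u v
    using cls_eq[OF that] by (simp add: \<psi>_def)
  have kill: "\<psi> t = \<one>\<^bsub>K Mod N\<^esub>" if "t \<in> T" for t
  proof -
    have "cls t \<in> N" "cls t \<in> carrier K"
      using mem_normal_closure[OF sub] that sub by (auto simp: N_def)
    then show ?thesis
      using K.coset_join2[OF _ N.subgroup_axioms] by (simp add: \<psi>_def)
  qed
  have eqI: "\<psi> u = \<psi> v" if "u \<in> W" "v \<in> W" "u @ inv_word v \<in> T" for u v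
  proof -
    have "\<psi> (inv_word v) \<otimes>\<^bsub>K Mod N\<^esub> \<psi> v = \<one>\<^bsub>K Mod N\<^esub>"
      using rel[OF inv_word_cancel[OF that(2)]] that app[of "inv_word v" v] app[of "[]" "[]"] clo[of "[]"]
      by (metis Q.l_cancel_one' append_Nil fp_words_simps(1) inv_word_closed)
    then show ?thesis
      using kill[OF that(3)] that app[of u "inv_word v"]
      by (metis Q.inv_equality Q.inv_inv clo inv_word_closed Q.inv_comm)
  qed
  have "cls w \<in> normal_closure K (cls ` T)" if w: "w \<in> W" "eval_word G w = \<one>" for w
  proof -
    have "\<psi> w = \<one>\<^bsub>K Mod N\<^esub>"
    proof (rule filling[where Q = "K Mod N" and \<psi> = \<psi> and \<sigma> = \<sigma>])
      fix x y assume xy: "x \<in> F" "y \<in> F"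
      then have xy': "x \<in> carrier G" "y \<in> carrier G" using F by auto
      from xy have "(sec x @ sec y) @ inv_word (sec (x \<otimes> y)) \<in> T"
        by (force simp: T_def)
      then have "\<psi> (sec x @ sec y) = \<psi> (sec (x \<otimes> y))"
        using xy' sec by (intro eqI) auto
      then show "\<sigma> (x \<otimes> y) = \<sigma> x \<otimes>\<^bsub>K Mod N\<^esub> \<sigma> y"
        using xy' sec app by (auto simp: \<sigma>_def)
    next
      fix l assume l: "l \<in> fp_letters S Ps" "eval_letter G l \<in> F"
      then have "[l] @ inv_word (sec (eval_letter G l)) \<in> T"
        by (auto simp: T_def L_def)
      then show "\<psi> [l] = \<sigma> (eval_letter G l)"
        unfolding \<sigma>_def using l F sec by (intro eqI) auto
    qed (use sec w app rel clo in \<open>auto simp: \<sigma>_def Q.group_axioms intro: rel\<close>)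
    then have "N #>\<^bsub>K\<^esub> cls w = N" by (simp add: \<psi>_def)
    then show ?thesis
      using K.coset_join1[OF _ cls_carrier[OF w(1)] N.subgroup_axioms] by (simp add: N_def)
  qed
  from relative_presentationI[OF surj T evT this] S finT
  show ?thesis unfolding rel_finitely_presented_def by blast
qed

end

section \<open>Displacements, and the data of a coarse retraction\<close>

context group
begin

text \<open>The label of the step from \<open>x\<close> to \<open>y\<close>. It is invariant under
  left translation and its word length is the word distance, so uniform bounds on distances become
  finiteness of sets of displacements.\<close>

definition disp :: "'a \<Rightarrow> 'a \<Rightarrow> 'a" where
  "disp x y = inv x \<otimes> y"

lemma disp_closed [simp]: "x \<in> carrier G \<Longrightarrow> y \<in> carrier G \<Longrightarrow> disp x y \<in> carrier G"
  by (simp add: disp_def)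

lemma inv_mult_cancel_left: "x \<in> carrier G \<Longrightarrow> y \<in> carrier G \<Longrightarrow> inv x \<otimes> (x \<otimes> y) = y"
  by (simp add: m_assoc[symmetric])

lemma disp_self [simp]: "x \<in> carrier G \<Longrightarrow> disp x x = \<one>"
  by (simp add: disp_def)

lemma inv_disp [simp]: "x \<in> carrier G \<Longrightarrow> y \<in> carrier G \<Longrightarrow> inv (disp x y) = disp y x"
  by (simp add: disp_def inv_mult_group)

lemma mult_disp [simp]: "x \<in> carrier G \<Longrightarrow> y \<in> carrier G \<Longrightarrow> x \<otimes> disp x y = y"
  by (simp add: disp_def m_assoc[symmetric])

lemma disp_trans [simp]:
  "x \<in> carrier G \<Longrightarrow> y \<in> carrier G \<Longrightarrow> z \<in> carrier G \<Longrightarrow> disp x y \<otimes> disp y z = disp x z"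
  using mult_disp[of y z] by (simp add: disp_def m_assoc)

lemma disp_mult [simp]: "x \<in> carrier G \<Longrightarrow> y \<in> carrier G \<Longrightarrow> disp x (x \<otimes> y) = y"
  by (simp add: disp_def m_assoc[symmetric])

end

text \<open>
  The point \<open>\<rho> i g\<close> lies near \<open>f g\<close> in the image of the coset \<open>g P\<^sub>i\<close>, which is a coset of the
  subgroup with index \<open>b i g\<close>; likewise \<open>\<pi> j h\<close> and \<open>c j h\<close> for the map \<open>r\<close>. The finite sets \<open>D\<close> and \<open>E\<close>
  contain the displacements that have to be controlled.
\<close>

locale coarse_retract =
  G: relative_words G S Ps + H: relative_words H T Qs
  for G :: "'g monoid" (structure) and S Ps and H :: "'h monoid" and T Qs +
  fixes f :: "'g \<Rightarrow> 'h" and \<rho> :: "nat \<Rightarrow> 'g \<Rightarrow> 'h" and b :: "nat \<Rightarrow> 'g \<Rightarrow> nat"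
    and r :: "'h \<Rightarrow> 'g" and \<pi> :: "nat \<Rightarrow> 'h \<Rightarrow> 'g" and c :: "nat \<Rightarrow> 'h \<Rightarrow> nat"
    and sec :: "'h \<Rightarrow> 'h fp_letter list"
    and D :: "'g set" and E :: "'h set"
  assumes f_closed [simp]: "g \<in> carrier G \<Longrightarrow> f g \<in> carrier H"
    and \<rho>_closed [simp]: "g \<in> carrier G \<Longrightarrow> i < length Ps \<Longrightarrow> \<rho> i g \<in> carrier H"
    and b_less [simp]: "g \<in> carrier G \<Longrightarrow> i < length Ps \<Longrightarrow> b i g < length Qs"
    and b_coset: "g \<in> carrier G \<Longrightarrow> i < length Ps \<Longrightarrow> p \<in> Ps ! i \<Longrightarrow> b i (g \<otimes> p) = b i g"
    and \<rho>_coset: "g \<in> carrier G \<Longrightarrow> i < length Ps \<Longrightarrow> p \<in> Ps ! i \<Longrightarrow>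
      group.disp H (\<rho> i g) (\<rho> i (g \<otimes> p)) \<in> Qs ! b i g"
    and r_closed [simp]: "h \<in> carrier H \<Longrightarrow> r h \<in> carrier G"
    and \<pi>_closed [simp]: "h \<in> carrier H \<Longrightarrow> j < length Qs \<Longrightarrow> \<pi> j h \<in> carrier G"
    and c_less [simp]: "h \<in> carrier H \<Longrightarrow> j < length Qs \<Longrightarrow> c j h < length Ps"
    and c_coset: "h \<in> carrier H \<Longrightarrow> j < length Qs \<Longrightarrow> q \<in> Qs ! j \<Longrightarrow> c j (h \<otimes>\<^bsub>H\<^esub> q) = c j h"
    and \<pi>_coset: "h \<in> carrier H \<Longrightarrow> j < length Qs \<Longrightarrow> q \<in> Qs ! j \<Longrightarrow>
      G.disp (\<pi> j h) (\<pi> j (h \<otimes>\<^bsub>H\<^esub> q)) \<in> Ps ! c j h"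
    and c_b: "g \<in> carrier G \<Longrightarrow> i < length Ps \<Longrightarrow> c (b i g) (\<rho> i g) = i"
    and \<pi>_\<rho>: "g \<in> carrier G \<Longrightarrow> i < length Ps \<Longrightarrow> G.disp g (\<pi> (b i g) (\<rho> i g)) \<in> Ps ! i"
    and sec_closed [simp]: "h \<in> carrier H \<Longrightarrow> sec h \<in> H.W"
    and eval_sec [simp]: "h \<in> carrier H \<Longrightarrow> eval_word H (sec h) = h"
    and D_carrier: "D \<subseteq> carrier G"
    and D_one: "\<one> \<in> D"
    and D_S: "s \<in> S \<Longrightarrow> s \<in> D \<and> inv s \<in> D"
    and D_r_f: "g \<in> carrier G \<Longrightarrow> G.disp g (r (f g)) \<in> D"
    and D_r: "h \<in> carrier H \<Longrightarrow> e \<in> E \<Longrightarrow> G.disp (r h) (r (h \<otimes>\<^bsub>H\<^esub> e)) \<in> D"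
    and D_\<pi>: "h \<in> carrier H \<Longrightarrow> j < length Qs \<Longrightarrow> G.disp (r h) (\<pi> j h) \<in> D"
    and D_\<pi>': "h \<in> carrier H \<Longrightarrow> j < length Qs \<Longrightarrow> G.disp (\<pi> j h) (r h) \<in> D"
    and E_carrier: "E \<subseteq> carrier H"
    and E_T: "t \<in> T \<Longrightarrow> t \<in> E \<and> inv\<^bsub>H\<^esub> t \<in> E"
    and short_letter: "g \<in> carrier G \<Longrightarrow> s \<in> S \<Longrightarrow>
      H.short E (sec (H.disp (f g) (f (g \<otimes> eval_letter G (Inl (s, \<epsilon>))))))"
    and short_to_\<rho>: "g \<in> carrier G \<Longrightarrow> i < length Ps \<Longrightarrow> H.short E (sec (H.disp (f g) (\<rho> i g)))"
    and short_from_\<rho>: "g \<in> carrier G \<Longrightarrow> i < length Ps \<Longrightarrow> H.short E (sec (H.disp (\<rho> i g) (f g)))"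
begin

text \<open>Three factors match the longest estimates: from \<open>\<pi> j h\<close> through
  \<open>r h\<close> and \<open>r h'\<close> to \<open>\<pi> j h'\<close> in
  \<open>\<phi>_short\<close>, and from \<open>g\<close> through \<open>r (f g)\<close> and
  \<open>r (\<rho> i g)\<close> to the point of \<pi> in \<open>\<tau>_detour\<close>.\<close>

definition "F = D <#> D <#> D"

lemma F3: "x \<in> D \<Longrightarrow> y \<in> D \<Longrightarrow> z \<in> D \<Longrightarrow> x \<otimes> y \<otimes> z \<in> F"
  by (auto simp: F_def set_mult_def)

lemma F2: "x \<in> D \<Longrightarrow> y \<in> D \<Longrightarrow> x \<otimes> y \<in> F"
  using F3[OF _ _ D_one, of x y] D_carrier by (auto simp: subset_iff)

lemma F1: "x \<in> D \<Longrightarrow> x \<in> F"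
  using F2[OF _ D_one, of x] D_carrier by (auto simp: subset_iff)

lemma F_carrier: "F \<subseteq> carrier G"
  using D_carrier by (auto simp: F_def set_mult_def)

end

text \<open>The added assumptions are the premises on \<open>Q\<close>, \<open>\<psi>\<close> and
  \<open>\<sigma>\<close> in the criterion \<open>rel_finitely_presentedI\<close>, with elements of
  \<open>Q\<close> of arbitrary type.\<close>

locale filling = coarse_retract + Q: group Q for Q :: "'q monoid" +
  fixes \<psi> :: "'a fp_letter list \<Rightarrow> 'q" and \<sigma> :: "'a \<Rightarrow> 'q"
  assumes \<psi>_closed [simp]: "u \<in> G.W \<Longrightarrow> \<psi> u \<in> carrier Q"
    and \<psi>_append: "u \<in> G.W \<Longrightarrow> v \<in> G.W \<Longrightarrow> \<psi> (u @ v) = \<psi> u \<otimes>\<^bsub>Q\<^esub> \<psi> v"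
    and \<psi>_rel: "(u, v) \<in> fp_rel G S Ps \<Longrightarrow> \<psi> u = \<psi> v"
    and \<sigma>_closed [simp]: "x \<in> carrier G \<Longrightarrow> \<sigma> x \<in> carrier Q"
    and \<sigma>_mult: "x \<in> F \<Longrightarrow> y \<in> F \<Longrightarrow> \<sigma> (x \<otimes> y) = \<sigma> x \<otimes>\<^bsub>Q\<^esub> \<sigma> y"
    and \<psi>_letter: "l \<in> fp_letters S Ps \<Longrightarrow> eval_letter G l \<in> F \<Longrightarrow> \<psi> [l] = \<sigma> (eval_letter G l)"
begin

section \<open>Traces in \<open>Q\<close> of words of \<open>H\<close>\<close>

lemma \<sigma>_one [simp]: "\<sigma> \<one> = \<one>\<^bsub>Q\<^esub>"
  using \<sigma>_mult[OF F1[OF D_one] F1[OF D_one]] by simp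

lemma \<sigma>_disp_trans:
  assumes "x \<in> carrier G" "y \<in> carrier G" "z \<in> carrier G" "G.disp x y \<in> F" "G.disp y z \<in> F"
  shows "\<sigma> (G.disp x y) \<otimes>\<^bsub>Q\<^esub> \<sigma> (G.disp y z) = \<sigma> (G.disp x z)"
  using \<sigma>_mult[OF assms(4,5)] assms(1-3) by simp

lemma \<sigma>_disp_inv:
  assumes "x \<in> carrier G" "y \<in> carrier G" "G.disp x y \<in> F" "G.disp y x \<in> F"
  shows "inv\<^bsub>Q\<^esub> \<sigma> (G.disp x y) = \<sigma> (G.disp y x)"
  using \<sigma>_disp_trans[OF assms(2,1,2,4,3)] assms by (intro Q.inv_equality) auto

lemma \<psi>_Nil [simp]: "\<psi> [] = \<one>\<^bsub>Q\<^esub>"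
  using \<psi>_append[of "[]" "[]"] Q.l_cancel_one'[of "\<psi> []" "\<psi> []"] by simp

text \<open>The map of the \<open>i\<close>-th peripheral factor into \<open>Q\<close>. It is
  multiplicative on the whole subgroup, whereas \<sigma> is so only for factors in \<open>F\<close>;
  by \<open>\<iota>_F\<close> the two agree on the elements of the subgroup that lie in
  \<open>F\<close>.\<close>

definition \<iota> where "\<iota> i p = \<psi> [Inr (i, p)]"

lemma \<iota>_closed [simp]: "i < length Ps \<Longrightarrow> p \<in> Ps ! i \<Longrightarrow> \<iota> i p \<in> carrier Q"
  by (simp add: \<iota>_def)

lemma \<iota>_mult: "i < length Ps \<Longrightarrow> p \<in> Ps ! i \<Longrightarrow> q \<in> Ps ! i \<Longrightarrow>
    \<iota> i (p \<otimes> q) = \<iota> i p \<otimes>\<^bsub>Q\<^esub> \<iota> i q"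
  using \<psi>_append[of "[Inr (i, p)]" "[Inr (i, q)]"] \<psi>_rel[OF fp_rel.merge[of i Ps p q G S]]
  by (simp add: \<iota>_def)

lemma \<iota>_one: "i < length Ps \<Longrightarrow> \<iota> i \<one> = \<one>\<^bsub>Q\<^esub>"
  using \<psi>_rel[OF fp_rel.unit[of i Ps G S]] by (simp add: \<iota>_def)

lemma \<iota>_F: "i < length Ps \<Longrightarrow> p \<in> Ps ! i \<Longrightarrow> p \<in> F \<Longrightarrow> \<iota> i p = \<sigma> p"
  using \<psi>_letter[of "Inr (i, p)"] by (simp add: \<iota>_def)

text \<open>
  The path in \<open>Q\<close> traced by \<open>r\<close> along a word of \<open>H\<close> started at \<open>h\<close>. The last factor for a cone edge is an inverse,
  rather than \<open>\<sigma>\<close> of the reversed displacement, so that merging cone edges needs no relator.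
\<close>

fun \<phi> :: "'b \<Rightarrow> 'b fp_letter \<Rightarrow> 'q" where
  "\<phi> h (Inl l) = \<sigma> (G.disp (r h) (r (h \<otimes>\<^bsub>H\<^esub> eval_letter H (Inl l))))"
| "\<phi> h (Inr (j, q)) = \<sigma> (G.disp (r h) (\<pi> j h)) \<otimes>\<^bsub>Q\<^esub>
     \<iota> (c j h) (G.disp (\<pi> j h) (\<pi> j (h \<otimes>\<^bsub>H\<^esub> q))) \<otimes>\<^bsub>Q\<^esub>
     inv\<^bsub>Q\<^esub> \<sigma> (G.disp (r (h \<otimes>\<^bsub>H\<^esub> q)) (\<pi> j (h \<otimes>\<^bsub>H\<^esub> q)))"

fun \<Phi> :: "'b \<Rightarrow> 'b fp_letter list \<Rightarrow> 'q" where
  "\<Phi> h [] = \<one>\<^bsub>Q\<^esub>"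
| "\<Phi> h (l # w) = \<phi> h l \<otimes>\<^bsub>Q\<^esub> \<Phi> (h \<otimes>\<^bsub>H\<^esub> eval_letter H l) w"

lemma Q_mem [simp]: "j < length Qs \<Longrightarrow> q \<in> Qs ! j \<Longrightarrow> q \<in> carrier H"
  using subgroup.mem_carrier[OF H.subgroup_Ps] by blast

lemma \<phi>_closed [simp]: "h \<in> carrier H \<Longrightarrow> l \<in> fp_letters T Qs \<Longrightarrow> \<phi> h l \<in> carrier Q"
proof (cases l)
  case (Inl a)
  assume "h \<in> carrier H" "l \<in> fp_letters T Qs"
  moreover from this have "eval_letter H (Inl a) \<in> carrier H"
    using Inl by (intro H.eval_letter_closed) simp
  ultimately show ?thesis using Inl by simp
next
  case (Inr a)
  assume "h \<in> carrier H" "l \<in> fp_letters T Qs"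
  then show ?thesis using Inr by (cases a) (auto simp: \<pi>_coset)
qed

lemma \<Phi>_closed [simp]: "h \<in> carrier H \<Longrightarrow> w \<in> H.W \<Longrightarrow> \<Phi> h w \<in> carrier Q"
  by (induction w arbitrary: h) auto

lemma \<Phi>_append:
  "h \<in> carrier H \<Longrightarrow> u \<in> H.W \<Longrightarrow> v \<in> H.W \<Longrightarrow>
    \<Phi> h (u @ v) = \<Phi> h u \<otimes>\<^bsub>Q\<^esub> \<Phi> (h \<otimes>\<^bsub>H\<^esub> eval_word H u) v"
  by (induction u arbitrary: h) (auto simp: Q.m_assoc H.m_assoc)

text \<open>For a cone letter with value in \<open>E\<close>, the points \<open>r h\<close> and
  \<open>r h'\<close> are close, hence so are \<open>\<pi> j h\<close> and
  \<open>\<pi> j h'\<close>. Then \<iota> of the middle step is \<sigma> of it, and the detour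
  collapses by relations on \<open>F\<close>.\<close>

lemma \<phi>_short:
  assumes "h \<in> carrier H" "l \<in> fp_letters T Qs" "eval_letter H l \<in> E"
  shows "\<phi> h l = \<sigma> (G.disp (r h) (r (h \<otimes>\<^bsub>H\<^esub> eval_letter H l)))"
proof (cases l)
  case (Inr a)
  then obtain j q where l: "l = Inr (j, q)" by (cases a) auto
  define h' where "h' = h \<otimes>\<^bsub>H\<^esub> q"
  have jq: "j < length Qs" "q \<in> Qs ! j" "q \<in> E" using assms l by auto
  have c [simp]: "h \<in> carrier H" "h' \<in> carrier H" using assms jq by (auto simp: h'_def)
  have rr: "G.disp (r h) (r h') \<in> D" using D_r[OF _ jq(3)] by (simp add: h'_def)
  have "G.disp (\<pi> j h) (r h) \<otimes> G.disp (r h) (r h') \<otimes> G.disp (r h') (\<pi> j h') \<in> F"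
    by (intro F3 rr D_\<pi> D_\<pi>') (use jq in auto)
  then have pp: "G.disp (\<pi> j h) (\<pi> j h') \<in> F" using jq by simp
  have "G.disp (r h) (r h') \<otimes> G.disp (r h') (\<pi> j h') \<in> F"
    by (intro F2 rr D_\<pi>) (use jq in auto)
  then have rp: "G.disp (r h) (\<pi> j h') \<in> F" using jq by simp
  have "\<phi> h l = \<sigma> (G.disp (r h) (\<pi> j h)) \<otimes>\<^bsub>Q\<^esub> \<sigma> (G.disp (\<pi> j h) (\<pi> j h')) \<otimes>\<^bsub>Q\<^esub>
      \<sigma> (G.disp (\<pi> j h') (r h'))"
    using jq pp \<pi>_coset[of h j q] by (simp add: l flip: h'_def add: \<iota>_F \<sigma>_disp_inv F1 D_\<pi> D_\<pi>')
  also have "\<dots> = \<sigma> (G.disp (r h) (r h'))"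
    using jq pp rp by (simp add: \<sigma>_disp_trans F1 D_\<pi> D_\<pi>')
  finally show ?thesis by (simp add: l h'_def)
qed simp

text \<open>Induction from the right end: the first letter and the value of the remaining word both
  lie in \<open>E\<close>, so both displacements under \<open>r\<close> lie in \<open>F\<close> and
  their \<sigma>-values multiply.\<close>

lemma \<Phi>_short:
  assumes "h \<in> carrier H" "H.short E w"
  shows "\<Phi> h w = \<sigma> (G.disp (r h) (r (h \<otimes>\<^bsub>H\<^esub> eval_word H w)))"
  using assms
proof (induction w arbitrary: h)
  case (Cons l w)
  define h' where "h' = h \<otimes>\<^bsub>H\<^esub> eval_letter H l"
  have l: "l \<in> fp_letters T Qs" "w \<in> H.W" "eval_letter H l \<in> E" using Cons.prems by (auto simp: H.short_def)
  have drop: "eval_word H (drop k w) \<in> E" for k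
    using Cons.prems(2) by (auto simp: H.short_def dest: spec[of _ "Suc k"])
  have c [simp]: "h' \<in> carrier H" using Cons.prems l by (simp add: h'_def)
  have "H.short E w" using Cons.prems(2) drop by (auto simp: H.short_def)
  then have "\<Phi> h' w = \<sigma> (G.disp (r h') (r (h' \<otimes>\<^bsub>H\<^esub> eval_word H w)))"
    by (intro Cons.IH) auto
  moreover have "\<phi> h l = \<sigma> (G.disp (r h) (r h'))"
    using \<phi>_short[OF Cons.prems(1) l(1,3)] by (simp add: h'_def)
  moreover have "G.disp (r h) (r h') \<in> F"
    using D_r[OF Cons.prems(1) l(3)] by (simp add: h'_def F1)
  moreover have "G.disp (r h') (r (h' \<otimes>\<^bsub>H\<^esub> eval_word H w)) \<in> F"
    using D_r[OF c drop[of 0]] by (simp add: F1)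
  moreover have "h' \<otimes>\<^bsub>H\<^esub> eval_word H w = h \<otimes>\<^bsub>H\<^esub> eval_word H (l # w)"
    using Cons.prems l by (simp add: h'_def H.m_assoc)
  ultimately show ?case
    using \<sigma>_disp_trans[of "r h" "r h'" "r (h' \<otimes>\<^bsub>H\<^esub> eval_word H w)"] Cons.prems l by (simp flip: h'_def)
qed simp

text \<open>Related words have equal values, so replacing a subword leaves the starting vertex of
  the rest unchanged. It remains to treat the defining relations, each from an arbitrary base
  point.\<close>

lemma \<Phi>_rel:
  assumes "(u, v) \<in> fp_rel H T Qs" "h \<in> carrier H"
  shows "\<Phi> h u = \<Phi> h v"
  using assms
proof (induction arbitrary: h rule: fp_rel.induct)
  case (cong u v x y)
  then show ?case
    using H.fp_rel_words[OF cong(1)] H.fp_rel_eval[OF cong(1)] by (simp add: \<Phi>_append H.eval_append)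
next
  case (cancel s e)
  have s: "s \<in> E" "inv\<^bsub>H\<^esub> s \<in> E" "s \<in> carrier H"
    using cancel H.S_carrier E_T by auto
  define x where "x = eval_letter H (Inl (s, e))"
  have x: "x \<in> E" "inv\<^bsub>H\<^esub> x \<in> E" "x \<in> carrier H" "eval_letter H (Inl (s, \<not> e)) = inv\<^bsub>H\<^esub> x"
    using s by (cases e; simp add: x_def)+
  have "h \<otimes>\<^bsub>H\<^esub> x \<otimes>\<^bsub>H\<^esub> inv\<^bsub>H\<^esub> x = h"
    using x cancel by (simp add: H.m_assoc)
  then have "G.disp (r h) (r (h \<otimes>\<^bsub>H\<^esub> x)) \<in> F" "G.disp (r (h \<otimes>\<^bsub>H\<^esub> x)) (r h) \<in> F"
    using D_r[of h x] D_r[of "h \<otimes>\<^bsub>H\<^esub> x" "inv\<^bsub>H\<^esub> x"] x cancel by (auto intro: F1)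
  then show ?case
    using x cancel \<open>h \<otimes>\<^bsub>H\<^esub> x \<otimes>\<^bsub>H\<^esub> inv\<^bsub>H\<^esub> x = h\<close> \<sigma>_disp_trans[of "r h" "r (h \<otimes>\<^bsub>H\<^esub> x)" "r h"]
    by (simp flip: x_def)
next
  case (merge j p q)
  define h' where "h' = h \<otimes>\<^bsub>H\<^esub> p"
  define h'' where "h'' = h' \<otimes>\<^bsub>H\<^esub> q"
  have c [simp]: "h \<in> carrier H" "h' \<in> carrier H" "h'' \<in> carrier H" "j < length Qs"
    and cc: "c j h' = c j h" and h'': "h \<otimes>\<^bsub>H\<^esub> (p \<otimes>\<^bsub>H\<^esub> q) = h''"
    using merge c_coset by (auto simp: h'_def h''_def H.m_assoc)
  have m: "G.disp (\<pi> j h) (\<pi> j h') \<in> Ps ! c j h" "G.disp (\<pi> j h') (\<pi> j h'') \<in> Ps ! c j h"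
    using \<pi>_coset[of h j p] \<pi>_coset[of h' j q] merge cc by (auto simp: h'_def h''_def)
  \<comment> \<open>Both edges lie over one coset, so \<open>c\<close> gives the same factor. The
    inverse closing the first edge cancels the opening step of the second, and the two middle terms
    merge inside that factor, however large they are.\<close>
  have "\<iota> (c j h) (G.disp (\<pi> j h) (\<pi> j h'')) =
     \<iota> (c j h) (G.disp (\<pi> j h) (\<pi> j h')) \<otimes>\<^bsub>Q\<^esub> \<iota> (c j h) (G.disp (\<pi> j h') (\<pi> j h''))"
    using \<iota>_mult[OF _ m] by simp
  then show ?case
    using m by (simp add: cc h'' flip: h'_def h''_def) (simp add: Q.m_assoc Q.inv_mult_cancel_left)
next
  case (unit j)
  then show ?case by (simp add: \<iota>_one)
qed auto

text \<open>A loop in \<open>H\<close> is equivalent to a product of conjugates of relators and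
  their inverses. A relator is a short loop, so \<open>\<Phi>_short\<close> gives it the value
  \<sigma> of a trivial displacement; the conjugating path cancels by
  \<open>\<Phi>_rel\<close>.\<close>

lemma \<Phi>_trivial:
  assumes R: "normal_closure H.K R = {A \<in> carrier H.K. fp_phi H A = \<one>\<^bsub>H\<^esub>}"
    and short: "\<And>A. A \<in> R \<Longrightarrow> \<exists>w. A = H.cls w \<and> H.short E w \<and> eval_word H w = \<one>\<^bsub>H\<^esub>"
    and w: "w \<in> H.W" "eval_word H w = \<one>\<^bsub>H\<^esub>" and h: "h \<in> carrier H"
  shows "\<Phi> h w = \<one>\<^bsub>Q\<^esub>"
proof -
  interpret K: group H.K by (rule H.group_K)
  \<comment> \<open>Triviality is demanded from every base point because conjugation moves the start
    of a relator. Closedness makes each factor of a product start at the same vertex.\<close>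
  define P where "P w \<longleftrightarrow> w \<in> H.W \<and> eval_word H w = \<one>\<^bsub>H\<^esub> \<and> (\<forall>h \<in> carrier H. \<Phi> h w = \<one>\<^bsub>Q\<^esub>)" for w
  have conj: "\<exists>w. P w \<and> A = H.cls w"
    if A: "A \<in> {g \<otimes>\<^bsub>H.K\<^esub> r \<otimes>\<^bsub>H.K\<^esub> inv\<^bsub>H.K\<^esub> g |g r. g \<in> carrier H.K \<and> r \<in> R}" for A
  proof -
    from A obtain B u where B: "B \<in> R" and u: "u \<in> H.W"
      and "A = H.cls u \<otimes>\<^bsub>H.K\<^esub> B \<otimes>\<^bsub>H.K\<^esub> inv\<^bsub>H.K\<^esub> H.cls u"
      by (auto simp: H.carrier_K)
    moreover obtain v where v: "B = H.cls v" "H.short E v" "eval_word H v = \<one>\<^bsub>H\<^esub>"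
      using short[OF B] by blast
    moreover from v have vW: "v \<in> H.W" by (simp add: H.short_def)
    ultimately have "A = H.cls (u @ v @ H.inv_word u)"
      by (simp add: H.cls_mult H.inv_cls)
    moreover have "P (u @ v @ H.inv_word u)"
    proof -
      have "\<Phi> h (u @ v @ H.inv_word u) = \<Phi> h (u @ H.inv_word u)" if "h \<in> carrier H" for h
        using that u v vW by (simp add: \<Phi>_append \<Phi>_short)
      then show ?thesis
        using \<Phi>_rel[OF H.word_inv_cancel[OF u]] H.fp_rel_eval[OF H.word_inv_cancel[OF u]] u v vW
        by (simp add: P_def H.eval_append)
    qed
    ultimately show ?thesis by blast
  qed
  have inv: "P (H.inv_word u)" if u: "P u" for u
  proof -
    have u': "u \<in> H.W" "eval_word H u = \<one>\<^bsub>H\<^esub>" using u by (auto simp: P_def)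
    then have "eval_word H (H.inv_word u) = \<one>\<^bsub>H\<^esub>"
      using H.fp_rel_eval[OF H.inv_word_cancel[OF u'(1)]] by (simp add: H.eval_append)
    moreover have "\<Phi> h (H.inv_word u) = \<one>\<^bsub>Q\<^esub>" if "h \<in> carrier H" for h
      using \<Phi>_rel[OF H.inv_word_cancel[OF u'(1)] that] u u' that calculation
      by (simp add: \<Phi>_append P_def)
    ultimately show ?thesis using u' by (simp add: P_def)
  qed
  have "\<exists>w. P w \<and> A = H.cls w" if "A \<in> normal_closure H.K R" for A
    using that unfolding normal_closure_def
  proof (induction rule: generate.induct)
    case one
    show ?case by (rule exI[of _ "[]"]) (simp add: P_def H.one_K)
  next
    case (incl A)
    then show ?case by (rule conj)
  next
    case (inv A)
    then obtain w where "P w" "A = H.cls w" using conj by blast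
    then show ?case using \<open>\<And>w. P w \<Longrightarrow> P (H.inv_word w)\<close>
      by (intro exI[of _ "H.inv_word w"]) (auto simp: H.inv_cls P_def)
  next
    case (eng A B)
    then obtain u v where "P u" "A = H.cls u" "P v" "B = H.cls v" by blast
    then show ?case
      by (intro exI[of _ "u @ v"]) (simp add: P_def H.cls_mult H.eval_append \<Phi>_append)
  qed
  moreover have "H.cls w \<in> normal_closure H.K R"
    using w by (simp add: R H.fp_phi_cls)
  \<comment> \<open>Membership in the normal closure yields only some good word in the class of
    \<open>w\<close>; \<open>\<Phi>_rel\<close> carries the value over to \<open>w\<close>
    itself.\<close>
  ultimately obtain w' where "P w'" "H.cls w = H.cls w'" by blast
  moreover from this have "(w, w') \<in> fp_rel H T Qs"
    using H.mem_cls[of w'] by (auto simp: P_def)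
  ultimately show ?thesis using \<Phi>_rel h by (auto simp: P_def)
qed

section \<open>Images in \<open>H\<close> of words of \<open>G\<close>, and the comparison with
  their values in \<open>Q\<close>\<close>

fun image_letter :: "'a \<Rightarrow> 'a fp_letter \<Rightarrow> 'b fp_letter list" where
  "image_letter g (Inl l) = sec (H.disp (f g) (f (g \<otimes> eval_letter G (Inl l))))"
| "image_letter g (Inr (i, p)) = sec (H.disp (f g) (\<rho> i g)) @
     [Inr (b i g, H.disp (\<rho> i g) (\<rho> i (g \<otimes> p)))] @ sec (H.disp (\<rho> i (g \<otimes> p)) (f (g \<otimes> p)))"

fun image_word :: "'a \<Rightarrow> 'a fp_letter list \<Rightarrow> 'b fp_letter list" where
  "image_word g [] = []"
| "image_word g (l # w) = image_letter g l @ image_word (g \<otimes> eval_letter G l) w"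

text \<open>The short path from \<open>g\<close> to its round trip \<open>r (f g)\<close>. These
  elements intertwine \<psi> with the trace of the image word.\<close>

definition \<tau> :: "'a \<Rightarrow> 'q" where
  "\<tau> g = \<sigma> (G.disp g (r (f g)))"

lemma \<tau>_closed [simp]: "g \<in> carrier G \<Longrightarrow> \<tau> g \<in> carrier Q"
  by (simp add: \<tau>_def)

lemma P_mem [simp]: "i < length Ps \<Longrightarrow> p \<in> Ps ! i \<Longrightarrow> p \<in> carrier G"
  using subgroup.mem_carrier[OF G.subgroup_Ps] by blast

lemma image_letter_closed:
  assumes g: "g \<in> carrier G" and l: "l \<in> fp_letters S Ps"
  shows "image_letter g l \<in> H.W \<and> eval_word H (image_letter g l) = H.disp (f g) (f (g \<otimes> eval_letter G l))"
proof (cases l)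
  case (Inl a)
  then show ?thesis using G.eval_letter_closed[OF l] g by simp
next
  case (Inr a)
  then obtain i p where "l = Inr (i, p)" "i < length Ps" "p \<in> Ps ! i"
    using l by (cases a) auto
  then show ?thesis using g \<rho>_coset[of g i p]
    by (simp add: H.eval_append)
qed

lemma image_word_closed:
  assumes "w \<in> G.W" "g \<in> carrier G"
  shows "image_word g w \<in> H.W \<and> eval_word H (image_word g w) = H.disp (f g) (f (g \<otimes> eval_word G w))"
  using assms
  by (induction w arbitrary: g) (auto simp: image_letter_closed H.eval_append G.m_assoc)

lemma r_f_\<rho>:
  assumes g: "g \<in> carrier G" and i: "i < length Ps"
  shows "G.disp (r (f g)) (r (\<rho> i g)) \<in> D" "G.disp (r (\<rho> i g)) (r (f g)) \<in> D"
proof -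
  \<comment> \<open>The suffix starting at position 0 is the whole chosen word, so shortness puts
    its value in \<open>E\<close>.\<close>
  have "H.disp (f g) (\<rho> i g) \<in> E" "H.disp (\<rho> i g) (f g) \<in> E"
    using short_to_\<rho>[OF g i] short_from_\<rho>[OF g i] g i
    by (auto simp: H.short_def dest: spec[of _ 0])
  from D_r[OF _ this(1), of "f g"] D_r[OF _ this(2), of "\<rho> i g"]
  show "G.disp (r (f g)) (r (\<rho> i g)) \<in> D" "G.disp (r (\<rho> i g)) (r (f g)) \<in> D"
    using g i by auto
qed

text \<open>The path from \<open>g\<close> through \<open>r (f g)\<close> and
  \<open>r (\<rho> i g)\<close> has three steps in \<open>D\<close>, so it collapses to one
  displacement in \<open>F\<close>. By \<open>\<pi>_\<rho>\<close> this lies in the peripheral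
  subgroup, where \<sigma> may be read as \<iota>.\<close>

lemma \<tau>_detour:
  fixes g i defines "\<eta> \<equiv> \<sigma> (G.disp (r (f g)) (r (\<rho> i g))) \<otimes>\<^bsub>Q\<^esub> \<sigma> (G.disp (r (\<rho> i g)) (\<pi> (b i g) (\<rho> i g)))"
  assumes g: "g \<in> carrier G" and i: "i < length Ps"
  shows "\<tau> g \<otimes>\<^bsub>Q\<^esub> \<eta> = \<iota> i (G.disp g (\<pi> (b i g) (\<rho> i g)))"
proof -
  let ?p = "\<pi> (b i g) (\<rho> i g)" and ?r = "r (\<rho> i g)"
  have D: "G.disp g (r (f g)) \<in> D" "G.disp (r (f g)) ?r \<in> D" "G.disp ?r ?p \<in> D"
    using g i by (auto intro: D_r_f r_f_\<rho> D_\<pi>)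
  have F: "G.disp (r (f g)) ?p \<in> F" "G.disp g ?p \<in> F"
    using F2[OF D(2,3)] F3[OF D] g i by auto
  have "\<tau> g \<otimes>\<^bsub>Q\<^esub> \<eta> = \<sigma> (G.disp g ?p)"
    using g i F D by (simp add: \<eta>_def \<tau>_def \<sigma>_disp_trans F1)
  then show ?thesis using \<iota>_F[OF i \<pi>_\<rho>[OF g i] F(2)] by simp
qed

text \<open>A commuting square over one edge. For a generator both sides are \<sigma> of the
  displacement from \<open>g\<close> to the round trip of its endpoint. For a cone edge
  \<open>c_b\<close> keeps the traced edge in factor \<open>i\<close>, so the square closes inside
  that factor without any bound on \<open>p\<close>.\<close>

lemma \<psi>_letter_image:
  assumes g: "g \<in> carrier G" and l: "l \<in> fp_letters S Ps"
  shows "\<psi> [l] \<otimes>\<^bsub>Q\<^esub> \<tau> (g \<otimes> eval_letter G l) = \<tau> g \<otimes>\<^bsub>Q\<^esub> \<Phi> (f g) (image_letter g l)"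
proof (cases l)
  case (Inl a)
  then obtain s e where l: "l = Inl (s, e)" "s \<in> S" using l by (cases a) auto
  define g' where "g' = g \<otimes> eval_letter G l"
  have lD: "eval_letter G l \<in> D" using D_S[of s] l by (cases e) auto
  have [simp]: "eval_letter G l \<in> carrier G" "g' \<in> carrier G"
    using lD D_carrier g by (auto simp: g'_def)
  have d: "eval_letter G l = G.disp g g'" using g by (simp add: g'_def)
  have image: "image_letter g l = sec (H.disp (f g) (f g'))" by (simp add: l(1) g'_def)
  have s: "H.short E (sec (H.disp (f g) (f g')))"
    using short_letter[OF g l(2)] by (simp add: g'_def l(1))
  then have "H.disp (f g) (f g') \<in> E"
    using g by (auto simp: H.short_def dest: spec[of _ 0])
  from D_r[OF _ this, of "f g"] have D: "G.disp (r (f g)) (r (f g')) \<in> D" using g by auto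
  have "\<Phi> (f g) (image_letter g l) = \<sigma> (G.disp (r (f g)) (r (f g')))"
    using \<Phi>_short[OF _ s, of "f g"] g image by simp
  moreover have "\<psi> [l] = \<sigma> (G.disp g g')"
    using \<psi>_letter[of l] lD l F1 by (simp flip: d)
  ultimately show ?thesis
    using \<sigma>_disp_trans[of g g' "r (f g')"] \<sigma>_disp_trans[of g "r (f g)" "r (f g')"] g D lD
    by (simp add: \<tau>_def F1 D_r_f flip: g'_def d)
next
  case (Inr a)
  then obtain i p where l: "l = Inr (i, p)" and i: "i < length Ps" and p: "p \<in> Ps ! i"
    using l by (cases a) auto
  define g' where "g' = g \<otimes> p"
  have g' [simp]: "g' \<in> carrier G" using g i p by (simp add: g'_def)
  \<comment> \<open>The path in \<open>Q\<close> from \<open>r (f g)\<close> to the point that \<pi>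
    selects near \<open>r (\<rho> i g)\<close>.\<close>
  define \<eta> where "\<eta> g = \<sigma> (G.disp (r (f g)) (r (\<rho> i g))) \<otimes>\<^bsub>Q\<^esub> \<sigma> (G.disp (r (\<rho> i g)) (\<pi> (b i g) (\<rho> i g)))" for g
  have \<eta>: "\<tau> x \<otimes>\<^bsub>Q\<^esub> \<eta> x = \<iota> i (G.disp x (\<pi> (b i x) (\<rho> i x)))" "\<eta> x \<in> carrier Q"
    if "x \<in> carrier G" for x
    using \<tau>_detour[OF that i] that i by (auto simp: \<eta>_def)
  define j q where "j = b i g" and "q = H.disp (\<rho> i g) (\<rho> i g')"
  have j: "b i g' = j" "j < length Qs" using b_coset[OF g i p] g i by (auto simp: j_def g'_def)
  have q: "q \<in> Qs ! j" "\<rho> i g \<otimes>\<^bsub>H\<^esub> q = \<rho> i g'"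
    using \<rho>_coset[OF g i p] g i g' by (auto simp: j_def q_def simp flip: g'_def)
  let ?\<pi> = "\<pi> j (\<rho> i g)" and ?\<pi>' = "\<pi> j (\<rho> i g')"
  have mem: "G.disp g ?\<pi> \<in> Ps ! i" "G.disp g' ?\<pi>' \<in> Ps ! i" "G.disp ?\<pi> ?\<pi>' \<in> Ps ! i"
    using \<pi>_\<rho>[OF g i] \<pi>_\<rho>[OF g' i] \<pi>_coset[of "\<rho> i g" j q] c_b[OF g i] q g i j by (auto simp: j_def)
  \<comment> \<open>Writing the return step as an inverse gives the trace of the image letter the
    form \<eta>, middle term, inverse of \<eta>.\<close>
  have inv': "\<sigma> (G.disp (r (\<rho> i g')) (r (f g'))) = inv\<^bsub>Q\<^esub> \<sigma> (G.disp (r (f g')) (r (\<rho> i g')))"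
    using \<sigma>_disp_inv[of "r (f g')" "r (\<rho> i g')"] r_f_\<rho>[OF g' i] i by (simp add: F1)
  have "\<Phi> (f g) (image_letter g l) = \<sigma> (G.disp (r (f g)) (r (\<rho> i g))) \<otimes>\<^bsub>Q\<^esub>
      (\<phi> (\<rho> i g) (Inr (j, q)) \<otimes>\<^bsub>Q\<^esub> \<sigma> (G.disp (r (\<rho> i g')) (r (f g'))))"
    using \<Phi>_short[OF _ short_to_\<rho>[OF g i], of "f g"] \<Phi>_short[OF _ short_from_\<rho>[OF g' i], of "\<rho> i g'"] g i q j
    by (simp add: l \<Phi>_append del: \<phi>.simps flip: g'_def j_def q_def)
  also have "\<dots> = \<eta> g \<otimes>\<^bsub>Q\<^esub> \<iota> i (G.disp ?\<pi> ?\<pi>') \<otimes>\<^bsub>Q\<^esub> inv\<^bsub>Q\<^esub> \<eta> g'"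
    using g i j q mem c_b[OF g i] by (simp add: \<eta>_def inv' Q.inv_mult_group Q.m_assoc flip: j_def)
  finally have \<Phi>: "\<Phi> (f g) (image_letter g l) = \<dots>" .
  \<comment> \<open>Multiplying by \<open>\<eta> g'\<close> on the right clears the inverse; this
    factor is cancelled again at the end.\<close>
  have "\<tau> g \<otimes>\<^bsub>Q\<^esub> \<Phi> (f g) (image_letter g l) \<otimes>\<^bsub>Q\<^esub> \<eta> g' = (\<tau> g \<otimes>\<^bsub>Q\<^esub> \<eta> g) \<otimes>\<^bsub>Q\<^esub> \<iota> i (G.disp ?\<pi> ?\<pi>')"
    using \<eta>(2)[OF g] \<eta>(2)[OF g'] i mem g by (simp add: \<Phi> Q.m_assoc)
  also have "\<dots> = \<iota> i (G.disp g ?\<pi>) \<otimes>\<^bsub>Q\<^esub> \<iota> i (G.disp ?\<pi> ?\<pi>')"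
    using \<eta>(1)[OF g] by (simp add: j_def)
  also have "\<dots> = \<iota> i (G.disp g ?\<pi>')"
    using \<iota>_mult[OF i mem(1,3)] g i j by simp
  also have "\<dots> = \<iota> i (p \<otimes> G.disp g' ?\<pi>')"
    using G.disp_trans[of g g' ?\<pi>'] g i j p by (simp add: g'_def)
  also have "\<dots> = \<psi> [l] \<otimes>\<^bsub>Q\<^esub> \<tau> g' \<otimes>\<^bsub>Q\<^esub> \<eta> g'"
    using \<iota>_mult[OF i p mem(2)] \<eta>[OF g'] i p j by (simp add: l Q.m_assoc flip: \<iota>_def)
  finally show ?thesis
    using \<eta>(2)[OF g'] image_letter_closed[OF g \<open>l \<in> fp_letters S Ps\<close>] g i p
    by (simp add: l flip: g'_def)
qed

text \<open>The squares of consecutive letters are glued along their common \<tau>.\<close>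

lemma \<psi>_word_image:
  assumes "w \<in> G.W" "g \<in> carrier G"
  shows "\<psi> w \<otimes>\<^bsub>Q\<^esub> \<tau> (g \<otimes> eval_word G w) = \<tau> g \<otimes>\<^bsub>Q\<^esub> \<Phi> (f g) (image_word g w)"
  using assms
proof (induction w arbitrary: g)
  case (Cons l w)
  define g' where "g' = g \<otimes> eval_letter G l"
  have l: "l \<in> fp_letters S Ps" "w \<in> G.W" and g': "g' \<in> carrier G"
    using Cons.prems by (auto simp: g'_def)
  have "\<psi> (l # w) \<otimes>\<^bsub>Q\<^esub> \<tau> (g \<otimes> eval_word G (l # w)) = \<psi> [l] \<otimes>\<^bsub>Q\<^esub> (\<psi> w \<otimes>\<^bsub>Q\<^esub> \<tau> (g' \<otimes> eval_word G w))"
    using \<psi>_append[of "[l]" w] Cons.prems l g' by (simp add: g'_def G.m_assoc Q.m_assoc)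
  also have "\<dots> = \<psi> [l] \<otimes>\<^bsub>Q\<^esub> \<tau> g' \<otimes>\<^bsub>Q\<^esub> \<Phi> (f g') (image_word g' w)"
    using Cons.IH[OF l(2) g'] image_word_closed[OF l(2) g'] l g' by (simp add: Q.m_assoc)
  also have "\<dots> = \<tau> g \<otimes>\<^bsub>Q\<^esub> \<Phi> (f g) (image_letter g l @ image_word g' w)"
    using \<psi>_letter_image[OF Cons.prems(2) l(1)] image_word_closed[OF l(2) g']
      image_letter_closed[OF Cons.prems(2) l(1)] Cons.prems g'
    by (simp add: \<Phi>_append Q.m_assoc flip: g'_def)
  finally show ?case by (simp add: g'_def)
qed simp

text \<open>For a loop at the identity both ends carry the same \<tau>, and the image is a loop in
  \<open>H\<close>, whose trace vanishes. Cancelling \<tau> leaves the claim.\<close>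

lemma \<psi>_trivial:
  assumes R: "normal_closure H.K R = {A \<in> carrier H.K. fp_phi H A = \<one>\<^bsub>H\<^esub>}"
    and short: "\<And>A. A \<in> R \<Longrightarrow> \<exists>w. A = H.cls w \<and> H.short E w \<and> eval_word H w = \<one>\<^bsub>H\<^esub>"
    and w: "w \<in> G.W" "eval_word G w = \<one>"
  shows "\<psi> w = \<one>\<^bsub>Q\<^esub>"
proof -
  have "\<Phi> (f \<one>) (image_word \<one> w) = \<one>\<^bsub>Q\<^esub>"
    using image_word_closed[OF w(1), of \<one>] w by (intro \<Phi>_trivial[OF R short]) auto
  then show ?thesis
    using \<psi>_word_image[OF w(1), of \<one>] w by simp
qed

end

section \<open>Word metrics, finite balls and nearby points of cosets\<close>

context group
begin

lemma foldr_mult_append: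
  "set us \<subseteq> carrier G \<Longrightarrow> set vs \<subseteq> carrier G \<Longrightarrow>
    foldr (\<otimes>) (us @ vs) \<one> = foldr (\<otimes>) us \<one> \<otimes> foldr (\<otimes>) vs \<one>"
proof (induction us)
  case Nil
  then have "foldr (\<otimes>) vs \<one> \<in> carrier G" by (induction vs) auto
  then show ?case by simp
next
  case (Cons u us)
  have "foldr (\<otimes>) ws \<one> \<in> carrier G" if "set ws \<subseteq> carrier G" for ws
    using that by (induction ws) auto
  with Cons show ?case by (simp add: m_assoc)
qed

lemma generate_word:
  assumes "S \<subseteq> carrier G" "g \<in> generate G S"
  shows "\<exists>ws. set ws \<subseteq> S \<union> m_inv G ` S \<and> foldr (\<otimes>) ws \<one> = g"
  using assms(2)
proof (induction rule: generate.induct)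
  case one
  show ?case by (rule exI[of _ "[]"]) auto
next
  case (incl h)
  then show ?case using assms by (intro exI[of _ "[h]"]) auto
next
  case (inv h)
  then show ?case using assms by (intro exI[of _ "[inv h]"]) auto
next
  case (eng h1 h2)
  then obtain u v where "set u \<subseteq> S \<union> m_inv G ` S" "foldr (\<otimes>) u \<one> = h1"
    "set v \<subseteq> S \<union> m_inv G ` S" "foldr (\<otimes>) v \<one> = h2" by blast
  moreover have "S \<union> m_inv G ` S \<subseteq> carrier G" using assms by auto
  ultimately show ?case
    by (intro exI[of _ "u @ v"]) (subst foldr_mult_append, auto)
qed

lemma disp_coset:
  assumes "subgroup P G" "a \<in> carrier G" "x \<in> a <# P" "y \<in> a <# P"
  shows "disp x y \<in> P"
proof -
  obtain p q where "x = a \<otimes> p" "y = a \<otimes> q" "p \<in> P" "q \<in> P"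
    using assms by (auto simp: l_coset_def)
  moreover have "p \<in> carrier G" "q \<in> carrier G"
    using calculation assms subgroup.mem_carrier by auto
  moreover have "disp (a \<otimes> p) (a \<otimes> q) = inv p \<otimes> q"
    using calculation assms(2)
    by (simp add: disp_def inv_mult_group m_assoc inv_mult_cancel_left)
  ultimately show ?thesis using assms(1) by (simp add: subgroup.m_closed subgroup.m_inv_closed)
qed

end

lemma (in group) l_coset_mult:
  assumes "subgroup P G" "a \<in> carrier G" "p \<in> P" shows "(a \<otimes> p) <# P = a <# P"
  using l_repr_independence[of "a \<otimes> p" a P] assms by (auto simp: l_coset_def)

lemma (in group) self_mem_l_coset: "subgroup P G \<Longrightarrow> a \<in> carrier G \<Longrightarrow> a \<in> a <# P"
  using subgroup.one_closed by (force simp: l_coset_def)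

text \<open>Because \<open>S\<close> generates, the minimum in \<open>word_length\<close> is
  attained, so the ball consists of values of bounded words over a finite alphabet.\<close>

lemma finite_ball:
  fixes G (structure)
  assumes "group G" and "finite_gen_set G S"
  shows "finite {g \<in> carrier G. real (word_length G S g) \<le> c}" (is "finite ?B")
proof -
  interpret group G by fact
  let ?L = "{ws. set ws \<subseteq> S \<union> m_inv G ` S \<and> length ws \<le> nat \<lfloor>c\<rfloor>}"
  have "?B \<subseteq> (\<lambda>ws. foldr (\<otimes>) ws \<one>) ` ?L"
  proof
    fix g assume g: "g \<in> ?B"
    then have "\<exists>n ws. length ws = n \<and> set ws \<subseteq> S \<union> m_inv G ` S \<and> foldr (\<otimes>) ws \<one> = g"
      using generate_word[of S g] assms by (auto simp: finite_gen_set_def)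
    from LeastI_ex[OF this] obtain ws where "length ws = word_length G S g"
      "set ws \<subseteq> S \<union> m_inv G ` S" "foldr (\<otimes>) ws \<one> = g"
      unfolding word_length_def by blast
    moreover have "word_length G S g \<le> nat \<lfloor>c\<rfloor>" using g by (simp add: le_nat_floor)
    ultimately show "g \<in> (\<lambda>ws. foldr (\<otimes>) ws \<one>) ` ?L" by auto
  qed
  moreover have "finite ((\<lambda>ws. foldr (\<otimes>) ws \<one>) ` ?L)"
    using assms by (intro finite_imageI finite_lists_length_le) (auto simp: finite_gen_set_def)
  ultimately show ?thesis by (rule finite_subset)
qed

lemma word_dist_disp: "group G \<Longrightarrow> word_dist G S x y = word_length G S (group.disp G x y)"
  by (simp add: word_dist_def group.disp_def)

text \<open>The distance from \<open>x\<close> to its right translate by \<open>a\<close> is the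
  length of \<open>a\<close>, independent of \<open>x\<close>. All image displacements therefore lie
  in one ball.\<close>

lemma lipschitz_map_finite_disp:
  assumes "group G" "group H" "finite_gen_set H SH" "lipschitz_map G SG H SH L C f" "L \<ge> 0"
    and A: "finite A" "A \<subseteq> carrier G"
  shows "finite {group.disp H (f x) (f (x \<otimes>\<^bsub>G\<^esub> a)) | x a. x \<in> carrier G \<and> a \<in> A}"
proof -
  interpret G: group G by fact
  interpret H: group H by fact
  define m where "m = Max (word_length G SG ` A)"
  show ?thesis
  proof (rule finite_subset[OF _ finite_ball[OF H.is_group assms(3), of "L * m + C"]], safe)
    fix x a assume x: "x \<in> carrier G" "a \<in> A"
    then have a: "a \<in> carrier G" using A by auto
    have fx: "f y \<in> carrier H" if "y \<in> carrier G" for y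
      using assms(4) that by (auto simp: lipschitz_map_def)
    show "H.disp (f x) (f (x \<otimes>\<^bsub>G\<^esub> a)) \<in> carrier H" using x a fx by simp
    have "real (word_dist H SH (f x) (f (x \<otimes>\<^bsub>G\<^esub> a))) \<le> L * real (word_dist G SG x (x \<otimes>\<^bsub>G\<^esub> a)) + C"
      using assms(4) x a by (simp add: lipschitz_map_def)
    moreover have "word_length G SG a \<le> m" using x A by (simp add: m_def)
    then have "L * real (word_length G SG a) \<le> L * real m" using assms(5) by (simp add: mult_left_mono)
    ultimately show "real (word_length H SH (H.disp (f x) (f (x \<otimes>\<^bsub>G\<^esub> a)))) \<le> L * real m + C"
      using x a by (simp add: word_dist_disp[OF H.is_group] word_dist_disp[OF G.is_group])
  qed
qed

lemma hausdorff_dist_less: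
  assumes "hausdorff_dist d A B < ereal M" "x \<in> A"
  shows "\<exists>y \<in> B. real (d x y) < M"
proof -
  have "Complete_Lattices.Inf ((\<lambda>y. ereal (real (d x y))) ` B)
      \<le> Complete_Lattices.Sup ((\<lambda>x. Complete_Lattices.Inf ((\<lambda>y. ereal (real (d x y))) ` B)) ` A)"
    using assms(2) by (intro Sup_upper) auto
  also have "\<dots> < ereal M" using assms(1) by (simp add: hausdorff_dist_def)
  finally show ?thesis by (auto simp: Inf_less_iff)
qed

text \<open>Serves both \<open>f\<close> and \<open>r\<close>. The Hausdorff bound gives, for each
  element and not merely each coset, a point of the image coset near the image of that element; this
  point also represents the coset.\<close>

lemma lipschitz_pair_map_section:
  assumes G: "group_pair G Ps" and H: "group_pair H Qs" and SH: "finite_gen_set H SH"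
    and f: "lipschitz_pair_map G Ps SG H Qs SH L C M f f2"
  obtains B \<rho> where "finite B" "B \<subseteq> carrier H"
    "\<And>g i. g \<in> carrier G \<Longrightarrow> i < length Ps \<Longrightarrow> fst (f2 (i, g <#\<^bsub>G\<^esub> Ps ! i)) < length Qs"
    "\<And>g i. g \<in> carrier G \<Longrightarrow> i < length Ps \<Longrightarrow> \<rho> i g \<in> carrier H"
    "\<And>g i. g \<in> carrier G \<Longrightarrow> i < length Ps \<Longrightarrow> f2 (i, g <#\<^bsub>G\<^esub> Ps ! i) =
       (fst (f2 (i, g <#\<^bsub>G\<^esub> Ps ! i)), \<rho> i g <#\<^bsub>H\<^esub> Qs ! fst (f2 (i, g <#\<^bsub>G\<^esub> Ps ! i)))"
    "\<And>g i. g \<in> carrier G \<Longrightarrow> i < length Ps \<Longrightarrow> group.disp H (f g) (\<rho> i g) \<in> B"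
proof -
  interpret G: group G using G by (simp add: group_pair_def)
  interpret H: group H using H by (simp add: group_pair_def)
  define B where "B = {h \<in> carrier H. real (word_length H SH h) \<le> M}"
  define near where "near i g y \<longleftrightarrow> y \<in> carrier H \<and> fst (f2 (i, g <#\<^bsub>G\<^esub> Ps ! i)) < length Qs \<and>
      f2 (i, g <#\<^bsub>G\<^esub> Ps ! i) = (fst (f2 (i, g <#\<^bsub>G\<^esub> Ps ! i)), y <#\<^bsub>H\<^esub> Qs ! fst (f2 (i, g <#\<^bsub>G\<^esub> Ps ! i))) \<and>
      H.disp (f g) y \<in> B" for i g y
  have ex: "\<exists>y. near i g y" if g: "g \<in> carrier G" and i: "i < length Ps" for g i
  proof -
    have P: "subgroup (Ps ! i) G" using G i by (auto simp: group_pair_def)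
    have A: "(i, g <#\<^bsub>G\<^esub> Ps ! i) \<in> pair_cosets G Ps" using g i by (auto simp: pair_cosets_def)
    then have "f2 (i, g <#\<^bsub>G\<^esub> Ps ! i) \<in> pair_cosets H Qs"
      using f by (auto simp: lipschitz_pair_map_def)
    then obtain j a where j: "f2 (i, g <#\<^bsub>G\<^esub> Ps ! i) = (j, a <#\<^bsub>H\<^esub> Qs ! j)" "j < length Qs" "a \<in> carrier H"
      by (auto simp: pair_cosets_def)
    have Q: "subgroup (Qs ! j) H" using H j by (auto simp: group_pair_def)
    have "f g \<in> f ` (g <#\<^bsub>G\<^esub> Ps ! i)"
      using G.self_mem_l_coset[OF P g] by (rule imageI)
    moreover have "hausdorff_dist (word_dist H SH) (f ` (g <#\<^bsub>G\<^esub> Ps ! i)) (a <#\<^bsub>H\<^esub> Qs ! j) < ereal M"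
      using f A j(1) by (auto simp: lipschitz_pair_map_def)
    ultimately have "\<exists>y \<in> a <#\<^bsub>H\<^esub> Qs ! j. real (word_dist H SH (f g) y) < M"
      by (intro hausdorff_dist_less)
    then obtain y where y: "y \<in> a <#\<^bsub>H\<^esub> Qs ! j" "real (word_dist H SH (f g) y) < M" ..
    have "y \<in> carrier H" using y j H.l_coset_subset_G[OF subgroup.subset[OF Q]] by auto
    moreover have "a <#\<^bsub>H\<^esub> Qs ! j = y <#\<^bsub>H\<^esub> Qs ! j"
      using H.l_repr_independence[OF y(1) j(3) Q] .
    moreover have "f g \<in> carrier H"
      using f g by (auto simp: lipschitz_pair_map_def lipschitz_map_def)
    ultimately show ?thesis using j y by (auto simp: near_def B_def word_dist_disp[OF H.is_group])
  qed
  define \<rho> where "\<rho> i g = (SOME y. near i g y)" for i g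
  have near: "near i g (\<rho> i g)" if "g \<in> carrier G" "i < length Ps" for g i
    unfolding \<rho>_def by (rule someI_ex[OF ex[OF that]])
  have B: "finite B" "B \<subseteq> carrier H" using finite_ball[OF H.is_group SH] by (auto simp: B_def)
  show ?thesis
    using B near[unfolded near_def, THEN conjunct2, THEN conjunct1]
      near[unfolded near_def, THEN conjunct1]
      near[unfolded near_def, THEN conjunct2, THEN conjunct2, THEN conjunct1]
      near[unfolded near_def, THEN conjunct2, THEN conjunct2, THEN conjunct2]
    by (rule that[of B \<rho>])
qed

section \<open>Extracting the finite data from a quasi-retraction\<close>

theorem theorem4p12:
  fixes G :: "'g monoid" and Ps :: "'g set list" and SG :: "'g set"
    and H :: "'h monoid" and Qs :: "'h set list" and SH :: "'h set"
  assumes "group_pair G Ps" and "group_pair H Qs"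
    and "finite_gen_set G SG" and "finite_gen_set H SH"
    and "quasi_retract_pair G Ps SG H Qs SH"
    and "rel_finitely_presented H Qs"
  shows "rel_finitely_presented G Ps"
proof -
  obtain T R where T: "finite T" "finite R" "relative_presentation H Qs T R"
    using assms(6) by (auto simp: rel_finitely_presented_def)
  interpret G: relative_words G SG Ps
    using assms(1,3) by (intro relative_words.intro relative_words_axioms.intro)
      (auto simp: group_pair_def finite_gen_set_def)
  interpret H: relative_words H T Qs
    using assms(2) T(3) by (intro relative_words.intro relative_words_axioms.intro)
      (auto simp: group_pair_def relative_presentation_def relative_generating_set_def)
  obtain L C M f f2 r r2 where qr: "quasi_retraction_pair G Ps SG H Qs SH L C M f f2 r r2"
    using assms(5) by (auto simp: quasi_retract_pair_def)
  have pf: "lipschitz_pair_map G Ps SG H Qs SH L C M f f2"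
    and pr: "lipschitz_pair_map H Qs SH G Ps SG L C M r r2"
    and rf: "\<And>g. g \<in> carrier G \<Longrightarrow> real (word_dist G SG (r (f g)) g) \<le> C"
    and r2f2: "\<And>A. A \<in> pair_cosets G Ps \<Longrightarrow> r2 (f2 A) = A"
    using qr by (auto simp: quasi_retraction_pair_def)
  have L: "L \<ge> 0" and lf: "lipschitz_map G SG H SH L C f" and lr: "lipschitz_map H SH G SG L C r"
    using pf pr by (auto simp: lipschitz_pair_map_def)
  have f [simp]: "\<And>g. g \<in> carrier G \<Longrightarrow> f g \<in> carrier H"
    and r [simp]: "\<And>h. h \<in> carrier H \<Longrightarrow> r h \<in> carrier G"
    using lf lr by (auto simp: lipschitz_map_def)
  define b where "b i g = fst (f2 (i, g <#\<^bsub>G\<^esub> Ps ! i))" for i g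
  define c where "c j h = fst (r2 (j, h <#\<^bsub>H\<^esub> Qs ! j))" for j h
  obtain \<rho> BH where BH: "finite BH" "BH \<subseteq> carrier H"
    and b [simp]: "\<And>g i. g \<in> carrier G \<Longrightarrow> i < length Ps \<Longrightarrow> b i g < length Qs"
    and \<rho> [simp]: "\<And>g i. g \<in> carrier G \<Longrightarrow> i < length Ps \<Longrightarrow> \<rho> i g \<in> carrier H"
    and f2: "\<And>g i. g \<in> carrier G \<Longrightarrow> i < length Ps \<Longrightarrow>
        f2 (i, g <#\<^bsub>G\<^esub> Ps ! i) = (b i g, \<rho> i g <#\<^bsub>H\<^esub> Qs ! b i g)"
    and \<rho>B: "\<And>g i. g \<in> carrier G \<Longrightarrow> i < length Ps \<Longrightarrow> H.disp (f g) (\<rho> i g) \<in> BH"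
    unfolding b_def
  proof (rule lipschitz_pair_map_section[OF assms(1,2,4) pf], goal_cases)
    case 1
    from 1(2-) show ?case by (rule 1(1))
  qed
  obtain \<pi> BG where BG: "finite BG" "BG \<subseteq> carrier G"
    and c [simp]: "\<And>h j. h \<in> carrier H \<Longrightarrow> j < length Qs \<Longrightarrow> c j h < length Ps"
    and \<pi> [simp]: "\<And>h j. h \<in> carrier H \<Longrightarrow> j < length Qs \<Longrightarrow> \<pi> j h \<in> carrier G"
    and r2: "\<And>h j. h \<in> carrier H \<Longrightarrow> j < length Qs \<Longrightarrow>
        r2 (j, h <#\<^bsub>H\<^esub> Qs ! j) = (c j h, \<pi> j h <#\<^bsub>G\<^esub> Ps ! c j h)"
    and \<pi>B: "\<And>h j. h \<in> carrier H \<Longrightarrow> j < length Qs \<Longrightarrow> G.disp (r h) (\<pi> j h) \<in> BG"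
    unfolding c_def
  proof (rule lipschitz_pair_map_section[OF assms(2,1,3) pr], goal_cases)
    case 1
    from 1(2-) show ?case by (rule 1(1))
  qed
  define sec where "sec = inv_into H.W (eval_word H)"
  have Hsurj: "eval_word H ` H.W = carrier H"
    using T(3) by (auto simp: relative_presentation_def relative_generating_set_def H.carrier_K
        image_image H.fp_phi_cls cong: image_cong_simp)
  have sec [simp]: "sec h \<in> H.W" "eval_word H (sec h) = h" if "h \<in> carrier H" for h
    using Hsurj that by (simp_all add: sec_def inv_into_into f_inv_into_f)
  \<comment> \<open>Displacements in \<open>H\<close> that image paths bridge by chosen words:
    images of generator steps, and the steps between \<open>f g\<close> and
    \<open>\<rho> i g\<close> in both directions.\<close>
  define E1 where "E1 = {H.disp (f g) (f (g \<otimes>\<^bsub>G\<^esub> a)) | g a. g \<in> carrier G \<and> a \<in> SG \<union> m_inv G ` SG}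
    \<union> BH \<union> m_inv H ` BH"
  have SG: "finite SG" "SG \<subseteq> carrier G" "generate G SG = carrier G"
    using assms(3) by (auto simp: finite_gen_set_def)
  have E1: "finite E1" "E1 \<subseteq> carrier H"
  proof -
    show "finite E1" unfolding E1_def
      using lipschitz_map_finite_disp[OF G.is_group H.is_group assms(4) lf L, of "SG \<union> m_inv G ` SG"] SG BH
      by auto
    show "E1 \<subseteq> carrier H" using BH SG by (auto simp: E1_def)
  qed
  have RK: "R \<subseteq> carrier H.K"
    and Rker: "normal_closure H.K R = {A \<in> carrier H.K. fp_phi H A = \<one>\<^bsub>H\<^esub>}"
    using T(3) by (auto simp: relative_presentation_def)
  have "\<exists>w. w \<in> H.W \<and> A = H.cls w" if "A \<in> R" for A
    using RK that by (auto simp: H.carrier_K)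
  then obtain rep where rep: "\<And>A. A \<in> R \<Longrightarrow> rep A \<in> H.W \<and> A = H.cls (rep A)" by metis
  \<comment> \<open>All words that must be short: a representative of each relator of
    \<open>H\<close> and the connecting words. \<open>E\<close> is then read off from their letters
    and suffixes.\<close>
  define V where "V = rep ` R \<union> sec ` E1"
  have V: "finite V" "V \<subseteq> H.W" using T E1 rep by (auto simp: V_def)
  define E where "E = (\<Union>w\<in>V. (\<lambda>k. eval_word H (drop k w)) ` {..length w} \<union> eval_letter H ` set w)
    \<union> T \<union> m_inv H ` T"
  have short: "H.short E w" if "w \<in> V" for w
  proof -
    \<comment> \<open>Dropping beyond the length changes nothing, so the finitely many positions
      used in \<open>E\<close> cover every \<open>k\<close>.\<close>
    have "drop k w = drop (min k (length w)) w" for k by (simp add: min_def)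
    then have "eval_word H (drop k w) \<in> E" for k
      unfolding E_def using that by (metis (no_types, lifting) UN_I UnI1 atMost_iff image_eqI min.cobounded2)
    then show ?thesis using that V by (auto simp: H.short_def E_def)
  qed
  have "set w \<subseteq> fp_letters T Qs" "drop k w \<in> H.W" if "w \<in> V" for w k
    using that V set_drop_subset[of k w] by (auto simp: fp_words_def)
  then have E: "finite E" "E \<subseteq> carrier H"
    using V T H.S_carrier by (auto simp: E_def subset_iff)
  \<comment> \<open>\<open>E\<close> is fixed first, since displacements of \<open>r\<close> along
    \<open>E\<close> enter here. The ball of radius \<open>C\<close> is inverted because the
    quasi-retraction bounds the step from \<open>r (f g)\<close> to \<open>g\<close>, while
    \<open>D_r_f\<close> starts at \<open>g\<close>.\<close>
  define D where "D = {\<one>\<^bsub>G\<^esub>} \<union> SG \<union> m_inv G ` SG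
    \<union> m_inv G ` {g \<in> carrier G. real (word_length G SG g) \<le> C}
    \<union> {G.disp (r h) (r (h \<otimes>\<^bsub>H\<^esub> e)) | h e. h \<in> carrier H \<and> e \<in> E} \<union> BG \<union> m_inv G ` BG"
  have D: "finite D" "D \<subseteq> carrier G"
  proof -
    show "finite D" unfolding D_def
      using lipschitz_map_finite_disp[OF H.is_group G.is_group assms(3) lr L E] SG BG finite_ball[OF G.is_group assms(3)]
      by auto
    show "D \<subseteq> carrier G" using BG SG E by (auto simp: D_def)
  qed
  have b_coset: "b i (g \<otimes>\<^bsub>G\<^esub> p) = b i g"
    and \<rho>_coset: "H.disp (\<rho> i g) (\<rho> i (g \<otimes>\<^bsub>G\<^esub> p)) \<in> Qs ! b i g"
    if g: "g \<in> carrier G" and i: "i < length Ps" and p: "p \<in> Ps ! i" for g i p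
  proof -
    have gp: "g \<otimes>\<^bsub>G\<^esub> p \<in> carrier G"
      using g p subgroup.mem_carrier[OF G.subgroup_Ps[OF i]] by simp
    have co: "(g \<otimes>\<^bsub>G\<^esub> p) <#\<^bsub>G\<^esub> Ps ! i = g <#\<^bsub>G\<^esub> Ps ! i"
      by (rule G.l_coset_mult[OF G.subgroup_Ps[OF i] g p])
    then show b': "b i (g \<otimes>\<^bsub>G\<^esub> p) = b i g" by (simp add: b_def)
    have Q: "subgroup (Qs ! b i g) H" using H.subgroup_Ps g i by simp
    have "\<rho> i g <#\<^bsub>H\<^esub> Qs ! b i g = \<rho> i (g \<otimes>\<^bsub>G\<^esub> p) <#\<^bsub>H\<^esub> Qs ! b i g"
      using f2[OF g i] f2[OF gp i] by (simp add: b' co)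
    then show "H.disp (\<rho> i g) (\<rho> i (g \<otimes>\<^bsub>G\<^esub> p)) \<in> Qs ! b i g"
      using g gp i H.self_mem_l_coset[OF Q] by (intro H.disp_coset[OF Q, of "\<rho> i g"]) auto
  qed
  have c_coset: "c j (h \<otimes>\<^bsub>H\<^esub> q) = c j h"
    and \<pi>_coset: "G.disp (\<pi> j h) (\<pi> j (h \<otimes>\<^bsub>H\<^esub> q)) \<in> Ps ! c j h"
    if h: "h \<in> carrier H" and j: "j < length Qs" and q: "q \<in> Qs ! j" for h j q
  proof -
    have hq: "h \<otimes>\<^bsub>H\<^esub> q \<in> carrier H"
      using h q subgroup.mem_carrier[OF H.subgroup_Ps[OF j]] by simp
    have co: "(h \<otimes>\<^bsub>H\<^esub> q) <#\<^bsub>H\<^esub> Qs ! j = h <#\<^bsub>H\<^esub> Qs ! j"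
      by (rule H.l_coset_mult[OF H.subgroup_Ps[OF j] h q])
    then show c': "c j (h \<otimes>\<^bsub>H\<^esub> q) = c j h" by (simp add: c_def)
    have P: "subgroup (Ps ! c j h) G" using G.subgroup_Ps h j by simp
    have "\<pi> j h <#\<^bsub>G\<^esub> Ps ! c j h = \<pi> j (h \<otimes>\<^bsub>H\<^esub> q) <#\<^bsub>G\<^esub> Ps ! c j h"
      using r2[OF h j] r2[OF hq j] by (simp add: c' co)
    then show "G.disp (\<pi> j h) (\<pi> j (h \<otimes>\<^bsub>H\<^esub> q)) \<in> Ps ! c j h"
      using h hq j G.self_mem_l_coset[OF P] by (intro G.disp_coset[OF P, of "\<pi> j h"]) auto
  qed
  have c_b: "c (b i g) (\<rho> i g) = i"
    and \<pi>_\<rho>: "G.disp g (\<pi> (b i g) (\<rho> i g)) \<in> Ps ! i"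
    if g: "g \<in> carrier G" and i: "i < length Ps" for g i
  proof -
    have "r2 (b i g, \<rho> i g <#\<^bsub>H\<^esub> Qs ! b i g) = (i, g <#\<^bsub>G\<^esub> Ps ! i)"
      using f2[OF g i] r2f2[of "(i, g <#\<^bsub>G\<^esub> Ps ! i)"] g i by (auto simp: pair_cosets_def)
    \<comment> \<open>Cosets are tagged with their index, so the identity of \<open>r2\<close> after
      \<open>f2\<close> returns both the index \<open>i\<close> and the coset of
      \<open>g\<close>.\<close>
    note eq = HOL.trans[OF r2[OF \<rho>[OF g i] b[OF g i], symmetric] this]
    from eq show c': "c (b i g) (\<rho> i g) = i" by (rule Pair_inject)
    from eq have "\<pi> (b i g) (\<rho> i g) <#\<^bsub>G\<^esub> Ps ! i = g <#\<^bsub>G\<^esub> Ps ! i"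
      unfolding c' by (rule Pair_inject)
    then have "\<pi> (b i g) (\<rho> i g) \<in> g <#\<^bsub>G\<^esub> Ps ! i"
      using G.self_mem_l_coset[OF G.subgroup_Ps[OF i], of "\<pi> (b i g) (\<rho> i g)"] g i by simp
    then show "G.disp g (\<pi> (b i g) (\<rho> i g)) \<in> Ps ! i"
      using g i G.self_mem_l_coset[OF G.subgroup_Ps[OF i] g]
      by (intro G.disp_coset[OF G.subgroup_Ps[OF i] g])
  qed
  have D_r_f: "G.disp g (r (f g)) \<in> D" if g: "g \<in> carrier G" for g
  proof -
    have "real (word_length G SG (G.disp (r (f g)) g)) \<le> C"
      using rf[OF g] by (simp add: word_dist_disp[OF G.is_group])
    then have "inv\<^bsub>G\<^esub> (G.disp (r (f g)) g) \<in> D"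
      unfolding D_def using g by (intro UnI1 UnI2 imageI) auto
    then show ?thesis using g by simp
  qed
  have D_\<pi>: "G.disp (r h) (\<pi> j h) \<in> D" "G.disp (\<pi> j h) (r h) \<in> D"
    if "h \<in> carrier H" "j < length Qs" for h j
  proof -
    have "inv\<^bsub>G\<^esub> (G.disp (r h) (\<pi> j h)) \<in> D" "G.disp (r h) (\<pi> j h) \<in> D"
      using \<pi>B[OF that] by (auto simp: D_def)
    then show "G.disp (r h) (\<pi> j h) \<in> D" "G.disp (\<pi> j h) (r h) \<in> D" using that by auto
  qed
  have short_\<rho>: "H.short E (sec (H.disp (f g) (\<rho> i g)))" "H.short E (sec (H.disp (\<rho> i g) (f g)))"
    if "g \<in> carrier G" "i < length Ps" for g i
  proof -
    have "inv\<^bsub>H\<^esub> (H.disp (f g) (\<rho> i g)) \<in> E1" "H.disp (f g) (\<rho> i g) \<in> E1"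
      using \<rho>B[OF that] by (auto simp: E1_def)
    then show "H.short E (sec (H.disp (f g) (\<rho> i g)))" "H.short E (sec (H.disp (\<rho> i g) (f g)))"
      using that by (auto intro!: short simp: V_def)
  qed
  have short_letter: "H.short E (sec (H.disp (f g) (f (g \<otimes>\<^bsub>G\<^esub> eval_letter G (Inl (s, \<epsilon>))))))"
    if "g \<in> carrier G" "s \<in> SG" for g s \<epsilon>
  proof -
    have "eval_letter G (Inl (s, \<epsilon>)) \<in> SG \<union> m_inv G ` SG" using that by (cases \<epsilon>) auto
    then have "H.disp (f g) (f (g \<otimes>\<^bsub>G\<^esub> eval_letter G (Inl (s, \<epsilon>)))) \<in> E1"
      unfolding E1_def using that by blast
    then show ?thesis by (intro short) (simp add: V_def)
  qed
  have D_r: "G.disp (r h) (r (h \<otimes>\<^bsub>H\<^esub> e)) \<in> D" if "h \<in> carrier H" "e \<in> E" for h e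
    using that unfolding D_def by blast
  have D_one: "\<one>\<^bsub>G\<^esub> \<in> D" and D_S: "\<And>s. s \<in> SG \<Longrightarrow> s \<in> D \<and> inv\<^bsub>G\<^esub> s \<in> D"
    and E_T: "\<And>t. t \<in> T \<Longrightarrow> t \<in> E \<and> inv\<^bsub>H\<^esub> t \<in> E"
    by (auto simp: D_def E_def)
  interpret coarse_retract G SG Ps H T Qs f \<rho> b r \<pi> c sec D E
    by (intro coarse_retract.intro coarse_retract_axioms.intro G.relative_words_axioms H.relative_words_axioms;
      fact f \<rho> b b_coset \<rho>_coset r \<pi> c c_coset \<pi>_coset c_b \<pi>_\<rho> sec D(2) D_one D_S E(2) E_T
        D_r_f D_r D_\<pi> short_\<rho> short_letter)
  show ?thesis
  proof (rule G.rel_finitely_presentedI[OF SG(1) G.eval_surj[OF SG(3)]])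
    show "finite F" using D(1) by (simp add: F_def set_mult_def)
    show "F \<subseteq> carrier G" by (rule F_carrier)
  next
    fix Q :: "'g fp_letter list set set monoid" and \<psi> \<sigma> w
    assume "group Q" and "\<And>u. u \<in> G.W \<Longrightarrow> \<psi> u \<in> carrier Q"
      and "\<And>u v. u \<in> G.W \<Longrightarrow> v \<in> G.W \<Longrightarrow> \<psi> (u @ v) = \<psi> u \<otimes>\<^bsub>Q\<^esub> \<psi> v"
      and "\<And>u v. (u, v) \<in> fp_rel G SG Ps \<Longrightarrow> \<psi> u = \<psi> v"
      and "\<And>x. x \<in> carrier G \<Longrightarrow> \<sigma> x \<in> carrier Q"
      and "\<And>x y. x \<in> F \<Longrightarrow> y \<in> F \<Longrightarrow> \<sigma> (x \<otimes>\<^bsub>G\<^esub> y) = \<sigma> x \<otimes>\<^bsub>Q\<^esub> \<sigma> y"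
      and "\<And>l. l \<in> fp_letters SG Ps \<Longrightarrow> eval_letter G l \<in> F \<Longrightarrow> \<psi> [l] = \<sigma> (eval_letter G l)"
      and w: "w \<in> G.W" "eval_word G w = \<one>\<^bsub>G\<^esub>"
    then interpret filling G SG Ps H T Qs f \<rho> b r \<pi> c sec D E Q \<psi> \<sigma>
      by (intro filling.intro coarse_retract_axioms filling_axioms.intro) auto
    show "\<psi> w = \<one>\<^bsub>Q\<^esub>"
    proof (rule \<psi>_trivial[OF Rker _ w])
      fix A assume A: "A \<in> R"
      then have "A \<in> normal_closure H.K R" using H.mem_normal_closure[OF RK] by blast
      then have "eval_word H (rep A) = \<one>\<^bsub>H\<^esub>"
        using Rker rep[OF A] H.fp_phi_cls[of "rep A"] by auto
      then show "\<exists>w. A = H.cls w \<and> H.short E w \<and> eval_word H w = \<one>\<^bsub>H\<^esub>"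
        using rep[OF A] short[of "rep A"] A by (auto simp: V_def)
    qed
  qed
qed

end
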